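(* Let $T$ be a finite tree with vertex set $V$, let $C$ be its incidence relation and $I(T)\subseteq k[x_C]$ its tree ideal. There is a one-to-one correspondence between regular linear spaces for $k[x_C]/I(T)$ and partitions $Q$ of the vertex set $V$. If the partition of $V$ is $Q: U_0\sqcup U_1\sqcup\cdots\sqcup U_r$, then the corresponding regular linear space is $$L(Q)=L(U_0)\oplus L(U_1)\oplus\cdots\oplus L(U_r).$$
   Context: Let $k$ be a field and $T$ a finite tree with vertex set $V$ and edge set $E$ (edges are two-element subsets of $V$). The incidence relation is $C=\{(e,v)\in E\times V \mid v\in e\}$, and $k[x_C]$ is the polynomial ring in the variables $x_{e,v}$, $(e,v)\in C$. For distinct $v,w\in V$ let $vTw$ be the unique path from $v$ to $w$ in $T$, let $e=\{v,v'\}$ be the edge on this path incident to $v$ and $f=\{w,w'\}$ the edge on this path incident to $w$ (possibly $e=f$). The tree ideal $I(T)\subseteq k[x_C]$ is generated by the monomials $m_{v,w}=x_{e,v}x_{f,w}$ over all pairs of distinct vertices $v,w$. Put $h_{v,w}=x_{e,v'}-x_{f,w'}$; then $h_{w,v}=-h_{v,w}$. A variable difference is a difference of two distinct variables of $k[x_C]$. A linear subspace $L$ of the space of linear forms $\langle x_{e,v}\rangle_{(e,v)\in C}$ is a regular linear space for $k[x_C]/I(T)$ if it has a basis which is a regular sequence of variable differences for $k[x_C]/I(T)$ (the zero space, with empty basis, is included). A sequence of vertices $v,u,w$ is $T$-aligned if $u$ is on the path $vTw$. Let $U\subseteq V$ be nonempty and $S$ a tree with vertex set $U$ (a priori unrelated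 to $T$). $S$ flows with $T$ if whenever $v,u,w\in U$ are $T$-aligned, then $v,u,w$ are $S$-aligned. $L(S)$ denotes the linear span of the $h_{v,w}$ for $\{v,w\}$ an edge of $S$. For every nonempty $U\subseteq V$ there is a tree $S$ on $U$ flowing with $T$, and $L(S)$ is the same for all such $S$; it is denoted $L(U)$ (it is $0$ if $U$ is a singleton). *)

theory Defs
  imports Complex_Main "HOL-Algebra.QuotRing" "HOL-Library.Poly_Mapping" "HOL-Library.Disjoint_Sets"
begin

section \<open>Polynomial rings in a set of variables\<close>

type_synonym ('x, 'k) mpoly = "('x \<Rightarrow>\<^sub>0 nat) \<Rightarrow>\<^sub>0 'k"

definition Var :: "'x \<Rightarrow> ('x, 'k::field) mpoly" where
  "Var c = Poly_Mapping.single (Poly_Mapping.single c 1) 1"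

text \<open>\<open>('x, 'k) mpoly\<close> has a variable for every element of the type \<open>'x\<close>. The ring
  \<open>k[x\<^sub>C]\<close> consists of the polynomials in which only variables indexed by \<open>C\<close> occur.\<close>

definition poly_ring :: "'x set \<Rightarrow> ('x, 'k::field) mpoly ring" where
  "poly_ring C = \<lparr>carrier = {p. \<forall>m\<in>Poly_Mapping.keys p. Poly_Mapping.keys m \<subseteq> C},
     mult = (*), one = 1, zero = 0, add = (+)\<rparr>"

definition pscale :: "'k::field \<Rightarrow> ('x, 'k) mpoly \<Rightarrow> ('x, 'k) mpoly" where
  "pscale a p = Poly_Mapping.single 0 a * p"

global_interpretation mp: vector_space "pscale :: 'k::field \<Rightarrow> ('x, 'k) mpoly \<Rightarrow> _"
proof
  fix a b :: 'k and p q :: "('x, 'k) mpoly"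
  show "pscale a (p + q) = pscale a p + pscale a q"
    by (simp only: pscale_def distrib_left)
  show "pscale (a + b) p = pscale a p + pscale b p"
    by (simp only: pscale_def single_add distrib_right)
  show "pscale a (pscale b p) = pscale (a * b) p"
    by (simp only: pscale_def mult.assoc[symmetric] mult_single add_0)
  show "pscale 1 p = p"
    by (simp add: pscale_def)
qed

lemma keys_subset_mult:
  fixes p q :: "('x, 'k::field) mpoly"
  assumes p: "\<forall>m\<in>Poly_Mapping.keys p. Poly_Mapping.keys m \<subseteq> C"
    and q: "\<forall>m\<in>Poly_Mapping.keys q. Poly_Mapping.keys m \<subseteq> C"
  shows "\<forall>m\<in>Poly_Mapping.keys (p * q). Poly_Mapping.keys m \<subseteq> C"
proof
  fix m assume "m \<in> Poly_Mapping.keys (p * q)"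
  with keys_mult[of p q] have "m \<in> {a + b |a b. a \<in> Poly_Mapping.keys p \<and> b \<in> Poly_Mapping.keys q}"
    by (rule subsetD)
  then obtain a b where m: "m = a + b"
    and ab: "a \<in> Poly_Mapping.keys p" "b \<in> Poly_Mapping.keys q"
    by blast
  have "Poly_Mapping.keys m \<subseteq> Poly_Mapping.keys a \<union> Poly_Mapping.keys b"
    unfolding m by (rule Poly_Mapping.keys_add)
  also have "\<dots> \<subseteq> C"
    using bspec[OF p ab(1)] bspec[OF q ab(2)] by (rule Un_least)
  finally show "Poly_Mapping.keys m \<subseteq> C" .
qed

lemma cring_poly_ring: "cring (poly_ring C :: ('x, 'k::field) mpoly ring)"
proof (rule cringI)
  let ?R = "poly_ring C :: ('x, 'k) mpoly ring"
  have add: "p + q \<in> carrier ?R" if "p \<in> carrier ?R" "q \<in> carrier ?R" for p q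
  proof -
    have "Poly_Mapping.keys m \<subseteq> C" if "m \<in> Poly_Mapping.keys (p + q)" for m
    proof -
      have "m \<in> Poly_Mapping.keys p \<union> Poly_Mapping.keys q"
        using Poly_Mapping.keys_add \<open>m \<in> Poly_Mapping.keys (p + q)\<close> by (rule subsetD)
      then show ?thesis
        using \<open>p \<in> carrier ?R\<close> \<open>q \<in> carrier ?R\<close> unfolding poly_ring_def by auto
    qed
    then show ?thesis by (simp add: poly_ring_def)
  qed
  show "abelian_group ?R"
  proof (rule abelian_groupI)
    fix p assume "p \<in> carrier ?R"
    then have "- p \<in> carrier ?R" by (simp add: poly_ring_def)
    then show "\<exists>q\<in>carrier ?R. q \<oplus>\<^bsub>?R\<^esub> p = \<zero>\<^bsub>?R\<^esub>"
      by (intro bexI[of _ "- p"]) (simp_all add: poly_ring_def)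
  next
    fix p q assume "p \<in> carrier ?R" "q \<in> carrier ?R"
    then have "p + q \<in> carrier ?R" by (rule add)
    then show "p \<oplus>\<^bsub>?R\<^esub> q \<in> carrier ?R" by (simp add: poly_ring_def)
  qed (simp_all add: poly_ring_def ac_simps)
  show "Group.comm_monoid ?R"
  proof (rule comm_monoidI)
    fix p q assume "p \<in> carrier ?R" "q \<in> carrier ?R"
    then show "p \<otimes>\<^bsub>?R\<^esub> q \<in> carrier ?R"
      using keys_subset_mult[of p C q] by (simp add: poly_ring_def)
  qed (simp_all add: poly_ring_def ac_simps)
qed (simp add: poly_ring_def distrib_right)


section \<open>Regular sequences and regular linear spaces\<close>

definition nonzerodivisor :: "('a, 'b) ring_scheme \<Rightarrow> 'a \<Rightarrow> bool" where
  "nonzerodivisor A a \<longleftrightarrow>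
     a \<in> carrier A \<and> (\<forall>b\<in>carrier A. a \<otimes>\<^bsub>A\<^esub> b = \<zero>\<^bsub>A\<^esub> \<longrightarrow> b = \<zero>\<^bsub>A\<^esub>)"

text \<open>Regular sequences for the module \<open>M = R/I\<close>. Here
  \<open>M / (f\<^sub>1, \<dots>, f\<^sub>i) M\<close> is written as \<open>R / (I + (f\<^sub>1, \<dots>, f\<^sub>i))\<close>; the
  last clause is \<open>M \<noteq> (f\<^sub>1, \<dots>, f\<^sub>n) M\<close>.\<close>

definition regular_sequence :: "('a, 'b) ring_scheme \<Rightarrow> 'a set \<Rightarrow> 'a list \<Rightarrow> bool" where
  "regular_sequence R I fs \<longleftrightarrow>
     set fs \<subseteq> carrier R \<and>
     (\<forall>i<length fs. let J = Idl\<^bsub>R\<^esub> (I \<union> set (take i fs))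
                    in nonzerodivisor (R Quot J) (J +>\<^bsub>R\<^esub> (fs ! i))) \<and>
     Idl\<^bsub>R\<^esub> (I \<union> set fs) \<noteq> carrier R"

definition variable_difference :: "'x set \<Rightarrow> ('x, 'k::field) mpoly \<Rightarrow> bool" where
  "variable_difference C f \<longleftrightarrow> (\<exists>c\<in>C. \<exists>d\<in>C. c \<noteq> d \<and> f = Var c - Var d)"

definition linear_forms :: "'x set \<Rightarrow> ('x, 'k::field) mpoly set" where
  "linear_forms C = mp.span (Var ` C)"

definition regular_linear_space ::
  "'x set \<Rightarrow> ('x, 'k::field) mpoly set \<Rightarrow> ('x, 'k) mpoly set \<Rightarrow> bool" where
  "regular_linear_space C I L \<longleftrightarrow>
     mp.subspace L \<and> L \<subseteq> linear_forms C \<and>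
     (\<exists>fs. distinct fs \<and> mp.independent (set fs) \<and> mp.span (set fs) = L \<and>
           (\<forall>f\<in>set fs. variable_difference C f) \<and>
           regular_sequence (poly_ring C) I fs)"


section \<open>Finite trees\<close>

definition is_path :: "'v set \<Rightarrow> 'v set set \<Rightarrow> 'v \<Rightarrow> 'v \<Rightarrow> 'v list \<Rightarrow> bool" where
  "is_path V E v w p \<longleftrightarrow>
     p \<noteq> [] \<and> set p \<subseteq> V \<and> distinct p \<and> hd p = v \<and> last p = w \<and>
     successively (\<lambda>a b. {a, b} \<in> E) p"

definition is_cycle :: "'v set \<Rightarrow> 'v set set \<Rightarrow> 'v list \<Rightarrow> bool" where
  "is_cycle V E p \<longleftrightarrow>
     3 \<le> length p \<and> set p \<subseteq> V \<and> distinct p \<and>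
     successively (\<lambda>a b. {a, b} \<in> E) p \<and> {last p, hd p} \<in> E"

definition is_tree :: "'v set \<Rightarrow> 'v set set \<Rightarrow> bool" where
  "is_tree V E \<longleftrightarrow>
     finite V \<and> V \<noteq> {} \<and> (\<forall>e\<in>E. e \<subseteq> V \<and> card e = 2) \<and>
     (\<forall>v\<in>V. \<forall>w\<in>V. \<exists>p. is_path V E v w p) \<and>
     \<not> (\<exists>p. is_cycle V E p)"

definition tree_path :: "'v set \<Rightarrow> 'v set set \<Rightarrow> 'v \<Rightarrow> 'v \<Rightarrow> 'v list" where
  "tree_path V E v w = (THE p. is_path V E v w p)"

definition aligned :: "'v set \<Rightarrow> 'v set set \<Rightarrow> 'v \<Rightarrow> 'v \<Rightarrow> 'v \<Rightarrow> bool" where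
  "aligned V E v u w \<longleftrightarrow> u \<in> set (tree_path V E v w)"

definition flows_with :: "'v set \<Rightarrow> 'v set set \<Rightarrow> 'v set \<Rightarrow> 'v set set \<Rightarrow> bool" where
  "flows_with U S V E \<longleftrightarrow>
     (\<forall>v\<in>U. \<forall>u\<in>U. \<forall>w\<in>U. aligned V E v u w \<longrightarrow> aligned U S v u w)"


section \<open>Tree ideals and the spaces of partitions\<close>

definition incidence :: "'v set \<Rightarrow> 'v set set \<Rightarrow> ('v set \<times> 'v) set" where
  "incidence V E = {(e, v). e \<in> E \<and> v \<in> V \<and> v \<in> e}"

text \<open>The neighbours \<open>v'\<close> of \<open>v\<close> and \<open>w'\<close> of \<open>w\<close> on the path from \<open>v\<close> to
  \<open>w\<close>, for \<open>v \<noteq> w\<close>.\<close>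

definition nbr_first :: "'v set \<Rightarrow> 'v set set \<Rightarrow> 'v \<Rightarrow> 'v \<Rightarrow> 'v" where
  "nbr_first V E v w = hd (tl (tree_path V E v w))"

definition nbr_last :: "'v set \<Rightarrow> 'v set set \<Rightarrow> 'v \<Rightarrow> 'v \<Rightarrow> 'v" where
  "nbr_last V E v w = last (butlast (tree_path V E v w))"

definition tree_monomial ::
  "'v set \<Rightarrow> 'v set set \<Rightarrow> 'v \<Rightarrow> 'v \<Rightarrow> ('v set \<times> 'v, 'k::field) mpoly" where
  "tree_monomial V E v w =
     (let v' = nbr_first V E v w; w' = nbr_last V E v w
      in Var ({v, v'}, v) * Var ({w, w'}, w))"

definition tree_ideal :: "'v set \<Rightarrow> 'v set set \<Rightarrow> ('v set \<times> 'v, 'k::field) mpoly set" where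
  "tree_ideal V E =
     Idl\<^bsub>poly_ring (incidence V E)\<^esub> {tree_monomial V E v w | v w. v \<in> V \<and> w \<in> V \<and> v \<noteq> w}"

definition tree_diff ::
  "'v set \<Rightarrow> 'v set set \<Rightarrow> 'v \<Rightarrow> 'v \<Rightarrow> ('v set \<times> 'v, 'k::field) mpoly" where
  "tree_diff V E v w =
     (let v' = nbr_first V E v w; w' = nbr_last V E v w
      in Var ({v, v'}, v') - Var ({w, w'}, w'))"

text \<open>\<open>L(S)\<close>. Both \<open>h\<^sub>v\<^sub>,\<^sub>w\<close> and \<open>h\<^sub>w\<^sub>,\<^sub>v = - h\<^sub>v\<^sub>,\<^sub>w\<close>
  are among the generators.\<close>

definition tree_space ::
  "'v set \<Rightarrow> 'v set set \<Rightarrow> 'v set set \<Rightarrow> ('v set \<times> 'v, 'k::field) mpoly set" where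
  "tree_space V E S = mp.span {tree_diff V E v w | v w. v \<noteq> w \<and> {v, w} \<in> S}"

text \<open>\<open>L(U)\<close>, the common value of \<open>L(S)\<close> for all trees \<open>S\<close> on \<open>U\<close> flowing with
  the tree \<open>T = (V, E)\<close>.\<close>

definition subset_space ::
  "'v set \<Rightarrow> 'v set set \<Rightarrow> 'v set \<Rightarrow> ('v set \<times> 'v, 'k::field) mpoly set" where
  "subset_space V E U =
     (THE L. \<exists>S. is_tree U S \<and> flows_with U S V E \<and> L = tree_space V E S)"

definition is_direct_sum ::
  "('x, 'k::field) mpoly set \<Rightarrow> 'i set \<Rightarrow> ('i \<Rightarrow> ('x, 'k) mpoly set) \<Rightarrow> bool" where
  "is_direct_sum L A M \<longleftrightarrow>
     L = {\<Sum>i\<in>A. f i | f. \<forall>i\<in>A. f i \<in> M i} \<and>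
     (\<forall>f. (\<forall>i\<in>A. f i \<in> M i) \<and> (\<Sum>i\<in>A. f i) = 0 \<longrightarrow> (\<forall>i\<in>A. f i = 0))"

text \<open>The sum of the spaces \<open>L(U)\<close> for \<open>U \<in> Q\<close>; that this sum is direct is
  part of the theorem.\<close>

definition partition_space ::
  "'v set \<Rightarrow> 'v set set \<Rightarrow> 'v set set \<Rightarrow> ('v set \<times> 'v, 'k::field) mpoly set" where
  "partition_space V E Q = mp.span (\<Union>U\<in>Q. subset_space V E U)"

end

theory Submission
  imports Defs
begin

text \<open>
  A variable \<open>(e, v)\<close> with \<open>e = {v, a}\<close> is the edge \<open>e\<close> directed from \<open>v\<close> to \<open>a\<close>. Let
  \<open>half (e, v)\<close> be the set of vertices it points towards, that is, the component of \<open>a\<close> in the tree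
  without \<open>e\<close>. Two variables \<open>c\<close>, \<open>d\<close> face each other if \<open>half c \<union> half d = V\<close>; the generators
  of the tree ideal are exactly the products of facing variables (\<open>tree_ideal_eq\<close>). They point away
  from each other if \<open>half c \<inter> half d = {}\<close>; the corresponding differences are exactly the
  \<open>h\<^sub>v\<^sub>,\<^sub>w\<close> (\<open>half_disjoint_iff\<close>, \<open>tree_diff_eq\<close>).

  Algebra. A space \<open>L\<close> spanned by variable differences amounts to an equivalence relation on the
  variables, where \<open>c\<close> and \<open>d\<close> are equivalent if their difference lies in \<open>L\<close>. The first main
  result (\<open>regular_linear_space_iff\<close>) says that \<open>L\<close> is regular if and only if any two distinct
  equivalent variables point away from each other. Modulo \<open>L\<close> the quotient ring is the quotient of
  a polynomial ring, with one variable per class, by the monomial ideal generated by the products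
  of classes which contain facing variables (\<open>mem_J_iff\<close>). Suppose that any two variables in the same
  class point away from each other, and let \<open>A \<noteq> B\<close> be two classes. If the variables in \<open>A \<union> B\<close> still point away from each other, then for each monomial \<open>m\<close>
  outside the ideal one of \<open>A m\<close>, \<open>B m\<close> is outside it too (\<open>standard_mult_or\<close>), and this
  forces \<open>A - B\<close> to be a nonzerodivisor (\<open>outward_imp_nonzerodivisor\<close>). Otherwise there is an
  explicit monomial of degree one or two outside the ideal which is annihilated by both \<open>A\<close> and \<open>B\<close>
  (\<open>nonzerodivisor_imp_outward\<close>). Both arguments use only that the sets
  \<open>half c\<close> are finitely many, nonempty, distinct and closed under complements, and so they are
  carried out in that generality. No dimension or
  Cohen-Macaulay arguments are needed, nor the independence of the order of the sequence.

  Combinatorics. It remains to match equivalence relations of this kind with partitions of \<open>V\<close>.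
  For a set \<open>U\<close> of vertices the space \<open>L(U)\<close> is spanned by the \<open>h\<^sub>v\<^sub>,\<^sub>w\<close> with
  \<open>v, w \<in> U\<close> and no further vertex of \<open>U\<close> between \<open>v\<close> and \<open>w\<close> (\<open>subset_space_eq\<close>). From this
  description one reads off the equivalence relation of \<open>L(Q)\<close>
  (\<open>difference_in_partition_space\<close>), hence that \<open>L(Q)\<close> is regular and determines \<open>Q\<close>.
  Conversely, given a regular \<open>M\<close>, join \<open>v\<close> and \<open>w\<close> whenever \<open>h\<^sub>v\<^sub>,\<^sub>w \<in> M\<close>, and let \<open>Q\<close> be the
  partition into connected components. A shortest chain of such joins runs along
  a path of the tree, because if it turned back at some vertex, then two consecutive joins would
  belong to the same class and could be replaced by one. This yields \<open>L(Q) = M\<close>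
  (\<open>regular_imp_partition_space\<close>).
\<close>

section \<open>Substitutions and ideals in polynomial rings\<close>

text \<open>The monomial consisting of a single variable.\<close>
abbreviation mvar :: "'x \<Rightarrow> ('x \<Rightarrow>\<^sub>0 nat)" where "mvar c \<equiv> Poly_Mapping.single c 1"

lemma poly_mapping_sum_single:
  "p = (\<Sum>a\<in>Poly_Mapping.keys p. Poly_Mapping.single a (Poly_Mapping.lookup p a))"
  by (rule poly_mapping_eqI)
    (auto simp: lookup_sum lookup_single when_def in_keys_iff intro: sum.delta)

lemma poly_mapping_add_induct [case_names single add]:
  fixes p :: "'a \<Rightarrow>\<^sub>0 'b::comm_monoid_add"
  assumes single: "\<And>a c. P (Poly_Mapping.single a c)"
    and add: "\<And>p q. P p \<Longrightarrow> P q \<Longrightarrow> P (p + q)"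
  shows "P p"
proof -
  have zero: "P 0" using single[of undefined 0] by simp
  have "P (\<Sum>a\<in>A. Poly_Mapping.single a (Poly_Mapping.lookup p a))" if "finite A" for A
    using that by induction (auto intro: zero single add)
  then show ?thesis by (subst poly_mapping_sum_single) simp
qed

text \<open>The additive extension of a map \<open>f\<close> of the indices: coefficients of indices with the same
  image are added. It is used twice: on exponent vectors for the substitution of variables in a
  monomial, and on polynomials for the resulting linear map.\<close>
definition push :: "('a \<Rightarrow> 'b) \<Rightarrow> ('a \<Rightarrow>\<^sub>0 'c) \<Rightarrow> ('b \<Rightarrow>\<^sub>0 'c::comm_monoid_add)" where
  "push f p = (\<Sum>a\<in>Poly_Mapping.keys p. Poly_Mapping.single (f a) (Poly_Mapping.lookup p a))"

lemma push_eq_sum: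
  assumes "finite A" "Poly_Mapping.keys p \<subseteq> A"
  shows "push f p = (\<Sum>a\<in>A. Poly_Mapping.single (f a) (Poly_Mapping.lookup p a))"
  unfolding push_def using assms
  by (intro sum.mono_neutral_left) (auto simp: in_keys_iff)

lemma push_add: "push f (p + q) = push f p + push f q"
proof -
  let ?A = "Poly_Mapping.keys p \<union> Poly_Mapping.keys q"
  have "push f r = (\<Sum>a\<in>?A. Poly_Mapping.single (f a) (Poly_Mapping.lookup r a))"
    if "r \<in> {p, q, p + q}" for r
    using that Poly_Mapping.keys_add[of p q] by (intro push_eq_sum) auto
  then show ?thesis by (simp add: lookup_add single_add sum.distrib)
qed

lemma push_single: "push f (Poly_Mapping.single a c) = Poly_Mapping.single (f a) c"
  by (simp add: push_eq_sum[of "{a}"])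

lemma push_diff: "push f (p - q) = push f p - push f (q :: 'a \<Rightarrow>\<^sub>0 'b::ab_group_add)"
  using push_add[of f "p - q" q] by (simp add: algebra_simps)

lemma push_mult:
  fixes p q :: "'a::monoid_add \<Rightarrow>\<^sub>0 'c::semiring_0" and f :: "'a \<Rightarrow> 'b::monoid_add"
  assumes f: "\<And>a b. f (a + b) = f a + f b"
  shows "push f (p * q) = push f p * push f q"
proof (induction p rule: poly_mapping_add_induct)
  case (single a c)
  show ?case
    by (induction q rule: poly_mapping_add_induct)
      (simp_all add: push_add push_single mult_single f distrib_left)
qed (simp_all add: push_add distrib_right)

lemma lookup_Var_mult:
  "Poly_Mapping.lookup (Var c * p) (mvar c + m) = Poly_Mapping.lookup p m"
  by (induction p rule: poly_mapping_add_induct)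
    (simp_all add: Var_def mult_single lookup_single when_def distrib_left lookup_add)

lemma lookup_Var_mult_eq_0:
  assumes "Poly_Mapping.lookup m c = 0"
  shows "Poly_Mapping.lookup (Var c * p) m = 0"
proof (induction p rule: poly_mapping_add_induct)
  case (single a d)
  have "mvar c + a \<noteq> m" using assms by (auto simp: lookup_add)
  then show ?case by (simp add: Var_def mult_single lookup_single when_def)
qed (simp_all add: distrib_left lookup_add)

lemma mvar_dvd: 
  assumes "Poly_Mapping.lookup m c \<noteq> 0"
  obtains m' where "m = mvar c + m'"
proof
  show "m = mvar c + (m - mvar c)" using assms
    by (intro poly_mapping_eqI) (auto simp: lookup_add lookup_minus lookup_single when_def)
qed

lemma poly_ring_carrier_iff:
  "p \<in> carrier (poly_ring C) \<longleftrightarrow> (\<forall>m\<in>Poly_Mapping.keys p. Poly_Mapping.keys m \<subseteq> C)"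
  by (simp add: poly_ring_def)

lemma poly_ring_simps [simp]:
  "p \<oplus>\<^bsub>poly_ring C\<^esub> q = p + q" "p \<otimes>\<^bsub>poly_ring C\<^esub> q = p * q"
  "\<zero>\<^bsub>poly_ring C\<^esub> = 0" "\<one>\<^bsub>poly_ring C\<^esub> = 1"
  by (simp_all add: poly_ring_def)

lemma poly_ring_uminus:
  assumes p: "p \<in> carrier (poly_ring C)" shows "\<ominus>\<^bsub>poly_ring C\<^esub> p = - p"
proof -
  interpret R: cring "poly_ring C" by (rule cring_poly_ring)
  have "- p \<in> carrier (poly_ring C)" using p by (simp add: poly_ring_carrier_iff)
  then show ?thesis using R.minus_equality[of "- p" p] p by simp
qed

lemma ideal_poly_ring:
  assumes "ideal J (poly_ring C)"
  shows "J \<subseteq> carrier (poly_ring C)" and "0 \<in> J"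
    and "\<And>p q. p \<in> J \<Longrightarrow> q \<in> J \<Longrightarrow> p + q \<in> J"
    and "\<And>p q. p \<in> J \<Longrightarrow> q \<in> J \<Longrightarrow> p - q \<in> J"
    and "\<And>p q. p \<in> J \<Longrightarrow> q \<in> carrier (poly_ring C) \<Longrightarrow> q * p \<in> J"
proof -
  interpret ideal J "poly_ring C" by fact
  show sub: "J \<subseteq> carrier (poly_ring C)" using a_subset .
  show "0 \<in> J" using additive_subgroup.zero_closed[OF is_additive_subgroup] by simp
  show add: "p + q \<in> J" if "p \<in> J" "q \<in> J" for p q using additive_subgroup.a_closed[OF is_additive_subgroup that] by simp
  show "q * p \<in> J" if "p \<in> J" "q \<in> carrier (poly_ring C)" for p q using I_l_closed[OF that] by simp
  show "p - q \<in> J" if "p \<in> J" "q \<in> J" for p q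
  proof -
    have "q \<in> carrier (poly_ring C)" using that sub by blast
    then have "- q \<in> J"
      using additive_subgroup.a_inv_closed[OF is_additive_subgroup that(2)]
      by (simp only: poly_ring_uminus)
    from add[OF that(1) this] show ?thesis by simp
  qed
qed

lemma ideal_poly_ringI:
  assumes "J \<subseteq> carrier (poly_ring C)" and "0 \<in> J"
    and add: "\<And>p q. p \<in> J \<Longrightarrow> q \<in> J \<Longrightarrow> p + q \<in> J"
    and mult: "\<And>p q. p \<in> J \<Longrightarrow> q \<in> carrier (poly_ring C) \<Longrightarrow> q * p \<in> J"
  shows "ideal J (poly_ring C)"
proof -
  interpret R: cring "poly_ring C" by (rule cring_poly_ring)
  show ?thesis
  proof (rule idealI)
    show "ring (poly_ring C)" ..
    show "subgroup J (add_monoid (poly_ring C))"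
    proof (rule R.add.subgroupI)
      fix p assume p: "p \<in> J"
      then have "(- 1) * p \<in> J" by (intro mult) (auto simp: poly_ring_carrier_iff)
      then show "\<ominus>\<^bsub>poly_ring C\<^esub> p \<in> J" using p assms(1) poly_ring_uminus[of p C] by auto
    qed (use assms in auto)
    show "q \<otimes>\<^bsub>poly_ring C\<^esub> p \<in> J" if "p \<in> J" "q \<in> carrier (poly_ring C)" for p q
      using mult[OF that] by simp
    show "p \<otimes>\<^bsub>poly_ring C\<^esub> q \<in> J" if "p \<in> J" "q \<in> carrier (poly_ring C)" for p q
      using mult[OF that] by (simp add: mult.commute)
  qed
qed

text \<open>Regularity of a class in the quotient ring, expressed without cosets.\<close>
lemma nonzerodivisor_quotient_iff:
  assumes "ideal J (poly_ring C)" and f: "f \<in> carrier (poly_ring C)"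
  shows "nonzerodivisor (poly_ring C Quot J) (J +>\<^bsub>poly_ring C\<^esub> f) \<longleftrightarrow>
    (\<forall>g\<in>carrier (poly_ring C). f * g \<in> J \<longrightarrow> g \<in> J)"
proof -
  interpret ideal J "poly_ring C" by fact
  have zero: "J +>\<^bsub>poly_ring C\<^esub> g = J \<longleftrightarrow> g \<in> J" if "g \<in> carrier (poly_ring C)" for g
    using that a_rcos_zero[OF assms(1)] rcos_const_imp_mem by blast
  have carr: "carrier (poly_ring C Quot J) = (\<lambda>g. J +>\<^bsub>poly_ring C\<^esub> g) ` carrier (poly_ring C)"
    by (auto simp: FactRing_def A_RCOSETS_def')
  have mult: "(J +>\<^bsub>poly_ring C\<^esub> f) \<otimes>\<^bsub>poly_ring C Quot J\<^esub> (J +>\<^bsub>poly_ring C\<^esub> g)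
    = J +>\<^bsub>poly_ring C\<^esub> (f * g)"
    and closed: "f * g \<in> carrier (poly_ring C)"
    if "g \<in> carrier (poly_ring C)" for g
    using rcoset_mult_add[OF f that] m_closed[OF f that] by (simp_all add: FactRing_def)
  have z: "\<zero>\<^bsub>poly_ring C Quot J\<^esub> = J" by (simp add: FactRing_def)
  show ?thesis
    unfolding nonzerodivisor_def z carr using f mult zero closed by simp
qed

lemma keys_nat_add:
  fixes p q :: "'a \<Rightarrow>\<^sub>0 nat"
  shows "Poly_Mapping.keys (p + q) = Poly_Mapping.keys p \<union> Poly_Mapping.keys q"
  by (auto simp: in_keys_iff lookup_add)

lemma push_Var: "push (push f) (Var c :: ('x, 'k::field) mpoly) = Var (f c)"
  by (simp add: Var_def push_single)

lemma push_push_mult: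
  "push (push f) (p * q) = push (push f) p * push (push f) (q :: ('x, 'k::field) mpoly)"
  by (rule push_mult) (rule push_add)

lemma Var_carrier: "c \<in> C \<Longrightarrow> Var c \<in> carrier (poly_ring C)"
  by (simp add: Var_def poly_ring_carrier_iff)

lemma mult_carrier:
  assumes "p \<in> carrier (poly_ring C)" "q \<in> carrier (poly_ring C)"
  shows "p * q \<in> carrier (poly_ring C)"
  using keys_subset_mult[of p C q] assms by (simp add: poly_ring_carrier_iff)

lemma variable_difference_carrier:
  assumes "variable_difference C f" shows "f \<in> carrier (poly_ring C)"
proof -
  obtain c d where cd: "c \<in> C" "d \<in> C" "f = Var c - Var d"
    using assms unfolding variable_difference_def by blast
  have "Poly_Mapping.keys f \<subseteq> Poly_Mapping.keys (Var c :: ('a, 'b) mpoly) \<union> Poly_Mapping.keys (Var d :: ('a, 'b) mpoly)"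
    unfolding cd by (auto simp: in_keys_iff lookup_minus)
  then show ?thesis using cd by (auto simp: Var_def poly_ring_carrier_iff)
qed

section \<open>Merging variables modulo a quadratic monomial ideal\<close>

text \<open>The only properties of the sets \<open>H c = half c\<close> on which the algebra depends. Variables \<open>c\<close>, \<open>d\<close>
  face each other if \<open>H c \<union> H d = V\<close> and point away from each other if \<open>H c \<inter> H d = {}\<close>. In the
  application \<open>C\<close> is the incidence relation of the tree.\<close>
locale half_spaces =
  fixes C :: "'x set" and V :: "'v set" and H :: "'x \<Rightarrow> 'v set"
  assumes finite_C: "finite C"
    and H_subset: "c \<in> C \<Longrightarrow> H c \<subseteq> V"
    and H_nonempty: "c \<in> C \<Longrightarrow> H c \<noteq> {}"
    and inj_H: "inj_on H C"
    and H_compl: "c \<in> C \<Longrightarrow> \<exists>d\<in>C. H d = V - H c"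
begin

definition facing_products :: "('x, 'k::field) mpoly set" where
  "facing_products = {Var c * Var d | c d. c \<in> C \<and> d \<in> C \<and> H c \<union> H d = V}"

text \<open>Any two distinct variables whose difference lies in the span of \<open>X\<close> point away from each other.\<close>
definition outward :: "('x, 'k::field) mpoly set \<Rightarrow> bool" where
  "outward X \<longleftrightarrow> (\<forall>c\<in>C. \<forall>d\<in>C. c \<noteq> d \<longrightarrow> Var c - Var d \<in> mp.span X \<longrightarrow> H c \<inter> H d = {})"

end

text \<open>Identification of variables along a set \<open>X\<close> of variable differences.\<close>
locale merging = half_spaces C V H
  for C :: "'x set" and V :: "'v set" and H :: "'x \<Rightarrow> 'v set" +
  fixes X :: "('x, 'k::field) mpoly set"
  assumes X_diff: "\<And>f. f \<in> X \<Longrightarrow> variable_difference C f"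
begin

text \<open>A representative of the class of \<open>c\<close> under the relation \<open>Var c - Var d \<in> span X\<close>.\<close>
definition rep :: "'x \<Rightarrow> 'x" where
  "rep c = (SOME d. d \<in> C \<and> Var c - Var d \<in> mp.span X)"

lemma rep:
  assumes "c \<in> C" shows "rep c \<in> C" "Var c - Var (rep c) \<in> mp.span X"
proof -
  have "c \<in> C \<and> Var c - Var c \<in> mp.span X" using assms mp.span_zero by simp
  then have "rep c \<in> C \<and> Var c - Var (rep c) \<in> mp.span X" unfolding rep_def by (rule someI)
  then show "rep c \<in> C" "Var c - Var (rep c) \<in> mp.span X" by auto
qed

lemma rep_eq_iff:
  assumes "c \<in> C" "d \<in> C" shows "rep c = rep d \<longleftrightarrow> Var c - Var d \<in> mp.span X"
proof
  assume "rep c = rep d"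
  then show "Var c - Var d \<in> mp.span X"
    using mp.span_diff[OF rep(2)[OF assms(1)] rep(2)[OF assms(2)]] by simp
next
  assume cd: "Var c - Var d \<in> mp.span X"
  have "Var c - Var a \<in> mp.span X \<longleftrightarrow> Var d - Var a \<in> mp.span X" for a
    using mp.span_diff[OF _ cd, of "Var c - Var a"] mp.span_add[OF _ cd, of "Var d - Var a"] by auto
  then show "rep c = rep d" unfolding rep_def by simp
qed

text \<open>The substitution which replaces each variable by the representative of its class.\<close>
abbreviation \<pi> :: "('x, 'k) mpoly \<Rightarrow> ('x, 'k) mpoly" where
  "\<pi> \<equiv> push (push rep)"

text \<open>The standard monomials: those outside the monomial ideal generated by the images of
  the products of facing variables.\<close>
definition standard :: "('x \<Rightarrow>\<^sub>0 nat) \<Rightarrow> bool" where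
  "standard m \<longleftrightarrow> \<not> (\<exists>a\<in>C. \<exists>b\<in>C. H a \<union> H b = V \<and> (\<exists>k. m = mvar (rep a) + mvar (rep b) + k))"

lemma standard_factor: "standard (m + k) \<Longrightarrow> standard m"
  unfolding standard_def by (metis add.assoc)

text \<open>The ideal generated by the products of facing variables and by \<open>X\<close>, in the form in which it occurs
  in the definition of regular sequences.\<close>
definition J :: "('x, 'k) mpoly set" where
  "J = Idl\<^bsub>poly_ring C\<^esub> (Idl\<^bsub>poly_ring C\<^esub> facing_products \<union> X)"

lemma facing_products_carrier: "facing_products \<subseteq> carrier (poly_ring C)"
  unfolding facing_products_def by (auto intro!: mult_carrier Var_carrier)

lemma gens_carrier: "Idl\<^bsub>poly_ring C\<^esub> facing_products \<union> X \<subseteq> carrier (poly_ring C)"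
proof -
  interpret R: cring "poly_ring C" by (rule cring_poly_ring)
  show ?thesis
    using X_diff variable_difference_carrier
      ideal_poly_ring(1)[OF R.genideal_ideal[OF facing_products_carrier]] by blast
qed

lemma ideal_J: "ideal J (poly_ring C)"
proof -
  interpret R: cring "poly_ring C" by (rule cring_poly_ring)
  show ?thesis unfolding J_def by (rule R.genideal_ideal[OF gens_carrier])
qed

lemmas J_closed = ideal_poly_ring[OF ideal_J]

lemma J_gens: "facing_products \<subseteq> J" "X \<subseteq> J"
proof -
  interpret R: cring "poly_ring C" by (rule cring_poly_ring)
  show "facing_products \<subseteq> J" "X \<subseteq> J" unfolding J_def
    using R.genideal_self[OF gens_carrier] R.genideal_self[OF facing_products_carrier] by auto
qed

lemma span_subset_J: "mp.span X \<subseteq> J"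
proof (rule mp.span_minimal)
  show "mp.subspace J"
    unfolding mp.subspace_def pscale_def using J_closed by (auto simp: poly_ring_carrier_iff)
qed (rule J_gens)

lemma J_sum: "(\<And>a. a \<in> A \<Longrightarrow> h a \<in> J) \<Longrightarrow> sum h A \<in> J"
  by (induction A rule: infinite_finite_induct) (simp_all add: J_closed(2,3))

lemma keys_push_rep: "Poly_Mapping.keys m \<subseteq> C \<Longrightarrow> Poly_Mapping.keys (push rep (m :: 'x \<Rightarrow>\<^sub>0 nat)) \<subseteq> C"
  using keys_sum[of "\<lambda>a. Poly_Mapping.single (rep a) (Poly_Mapping.lookup m a)" "Poly_Mapping.keys m"] rep(1)
  unfolding push_def by (fastforce split: if_splits)

text \<open>The polynomials whose image under \<open>\<pi>\<close> has no standard monomial form an ideal containing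
  the generators of \<open>J\<close>.\<close>
lemma J_imp_nonstandard:
  assumes "g \<in> J" "m \<in> Poly_Mapping.keys (\<pi> g)" shows "\<not> standard m"
proof -
  interpret R: cring "poly_ring C" by (rule cring_poly_ring)
  let ?K = "{g \<in> carrier (poly_ring C). \<forall>m\<in>Poly_Mapping.keys (\<pi> g). \<not> standard m}"
  have id: "ideal ?K (poly_ring C)"
  proof (rule ideal_poly_ringI)
    show "0 \<in> ?K" by (simp add: push_def poly_ring_carrier_iff)
    show "p + q \<in> ?K" if "p \<in> ?K" "q \<in> ?K" for p q
    proof -
      have "Poly_Mapping.keys (p + q) \<subseteq> Poly_Mapping.keys p \<union> Poly_Mapping.keys q"
        "Poly_Mapping.keys (\<pi> (p + q)) \<subseteq> Poly_Mapping.keys (\<pi> p) \<union> Poly_Mapping.keys (\<pi> q)"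
        by (simp_all add: push_add Poly_Mapping.keys_add)
      then show ?thesis using that unfolding poly_ring_carrier_iff by blast
    qed
    show "q * p \<in> ?K" if p: "p \<in> ?K" and q: "q \<in> carrier (poly_ring C)" for p q
    proof -
      have "\<not> standard m" if "m \<in> Poly_Mapping.keys (\<pi> (q * p))" for m
      proof -
        obtain a b where "m = a + b" "b \<in> Poly_Mapping.keys (\<pi> p)"
          using \<open>m \<in> _\<close> keys_mult[of "\<pi> q" "\<pi> p"] unfolding push_push_mult by blast
        then show ?thesis using p standard_factor[of b a] by (auto simp: add.commute)
      qed
      then show ?thesis using p q mult_carrier[of q C p] by auto
    qed
  qed auto
  have "facing_products \<subseteq> ?K"
  proof
    fix f :: "('x, 'k) mpoly" assume "f \<in> facing_products"
    then obtain c d where cd: "c \<in> C" "d \<in> C" "H c \<union> H d = V" "f = Var c * Var d"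
      unfolding facing_products_def by blast
    have "\<not> standard m" if "m \<in> Poly_Mapping.keys (\<pi> f)" for m
    proof -
      have "m = mvar (rep c) + mvar (rep d) + 0"
        using that unfolding cd push_push_mult push_Var by (simp add: Var_def mult_single split: if_splits)
      then show ?thesis unfolding standard_def using cd by blast
    qed
    then show "f \<in> ?K" using cd by (auto intro!: mult_carrier Var_carrier)
  qed
  moreover have "X \<subseteq> ?K"
  proof
    fix f assume f: "f \<in> X"
    obtain c d where cd: "c \<in> C" "d \<in> C" "f = Var c - Var d"
      using X_diff[OF f] unfolding variable_difference_def by blast
    have "rep c = rep d" using rep_eq_iff[OF cd(1,2)] mp.span_base[OF f] cd by simp
    then have "\<pi> f = 0" unfolding cd by (simp add: push_diff push_Var)
    then show "f \<in> ?K" using variable_difference_carrier[OF X_diff[OF f]] by simp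
  qed
  ultimately have "J \<subseteq> ?K" unfolding J_def by (intro R.genideal_minimal id Un_least)
  then show ?thesis using assms by auto
qed

text \<open>A monomial is congruent modulo \<open>J\<close> to its image under the substitution of representatives.\<close>
lemma monomial_rep:
  "Poly_Mapping.keys m \<subseteq> C \<Longrightarrow> Poly_Mapping.single m a - Poly_Mapping.single (push rep m) a \<in> J"
proof (induction m arbitrary: a rule: poly_mapping_add_induct)
  case (single c n)
  show ?case using single
  proof (induction n arbitrary: a)
    case 0
    then show ?case using J_closed(2) by (simp add: push_def)
  next
    case (Suc n)
    have c: "c \<in> C" using Suc.prems by simp
    have keys: "Poly_Mapping.keys (Poly_Mapping.single c n) \<subseteq> C" using c by simp
    have "Poly_Mapping.single (Poly_Mapping.single c (Suc n)) a
      - Poly_Mapping.single (push rep (Poly_Mapping.single c (Suc n))) a =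
      Var c * (Poly_Mapping.single (Poly_Mapping.single c n) a
      - Poly_Mapping.single (push rep (Poly_Mapping.single c n)) a)
      + Poly_Mapping.single (push rep (Poly_Mapping.single c n)) a * (Var c - Var (rep c))"
      by (simp add: push_single Var_def mult_single right_diff_distrib single_add[symmetric] add.commute)
    also have "\<dots> \<in> J"
      using Suc.IH[OF keys] c rep span_subset_J
      by (intro J_closed(3,5) Var_carrier) (auto simp: push_single poly_ring_carrier_iff)
    finally show ?case .
  qed
next
  case (add p q)
  have keys: "Poly_Mapping.keys p \<subseteq> C" "Poly_Mapping.keys q \<subseteq> C" using add.prems by (auto simp: keys_nat_add)
  have "Poly_Mapping.single (p + q) a - Poly_Mapping.single (push rep (p + q)) a =
    Poly_Mapping.single p 1 * (Poly_Mapping.single q a - Poly_Mapping.single (push rep q) a)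
    + Poly_Mapping.single (push rep q) a * (Poly_Mapping.single p 1 - Poly_Mapping.single (push rep p) 1)"
    by (simp add: push_add mult_single right_diff_distrib add.commute)
  also have "\<dots> \<in> J"
    using add.IH keys keys_push_rep[OF keys(2)] by (intro J_closed(3,5)) (auto simp: poly_ring_carrier_iff)
  finally show ?case .
qed

lemma facing_rep_in_J:
  assumes "a \<in> C" "b \<in> C" "H a \<union> H b = V" shows "Var (rep a) * Var (rep b) \<in> J"
proof -
  have "Var (rep a) * Var (rep b) =
    Var a * Var b - (Var a * (Var b - Var (rep b)) + Var (rep b) * (Var a - Var (rep a)))"
    by (simp add: algebra_simps)
  also have "\<dots> \<in> J"
  proof -
    have "Var a * Var b \<in> J" using J_gens(1) assms unfolding facing_products_def by blast
    moreover have "Var a - Var (rep a) \<in> J" "Var b - Var (rep b) \<in> J"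
      using rep(2)[OF assms(1)] rep(2)[OF assms(2)] span_subset_J by auto
    ultimately show ?thesis
      using assms by (simp add: J_closed(3,4,5) Var_carrier rep(1))
  qed
  finally show ?thesis .
qed

text \<open>The membership criterion that makes the standard monomials in the representatives a basis of the
  quotient by \<open>J\<close>.\<close>
lemma mem_J_iff:
  assumes g: "g \<in> carrier (poly_ring C)"
  shows "g \<in> J \<longleftrightarrow> (\<forall>m\<in>Poly_Mapping.keys (\<pi> g). \<not> standard m)"
proof
  assume nonstandard: "\<forall>m\<in>Poly_Mapping.keys (\<pi> g). \<not> standard m"
  have "g - \<pi> g = (\<Sum>m\<in>Poly_Mapping.keys g. Poly_Mapping.single m (Poly_Mapping.lookup g m)
    - Poly_Mapping.single (push rep m) (Poly_Mapping.lookup g m))"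
    unfolding sum_subtractf push_def[of "push rep"] by (simp flip: poly_mapping_sum_single)
  also have "\<dots> \<in> J" using g by (intro J_sum monomial_rep) (simp add: poly_ring_carrier_iff)
  finally have 1: "g - \<pi> g \<in> J" .
  have keys_\<pi>: "Poly_Mapping.keys m \<subseteq> C" if "m \<in> Poly_Mapping.keys (\<pi> g)" for m
  proof -
    have "m \<in> (\<Union>a\<in>Poly_Mapping.keys g. Poly_Mapping.keys
        (Poly_Mapping.single (push rep a) (Poly_Mapping.lookup g a)))"
      using that unfolding push_def[of "push rep"] by (rule subsetD[OF keys_sum])
    then obtain a where "a \<in> Poly_Mapping.keys g" "m = push rep a" by (auto split: if_splits)
    then show ?thesis using g keys_push_rep by (auto simp: poly_ring_carrier_iff)
  qed
  have "(\<Sum>m\<in>Poly_Mapping.keys (\<pi> g). Poly_Mapping.single m (Poly_Mapping.lookup (\<pi> g) m)) \<in> J"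
  proof (rule J_sum)
    fix m assume m: "m \<in> Poly_Mapping.keys (\<pi> g)"
    then obtain a b k where ab: "a \<in> C" "b \<in> C" "H a \<union> H b = V"
      and mk: "m = mvar (rep a) + mvar (rep b) + k"
      using nonstandard unfolding standard_def by blast
    have "Poly_Mapping.single m (Poly_Mapping.lookup (\<pi> g) m)
      = Poly_Mapping.single k (Poly_Mapping.lookup (\<pi> g) m) * (Var (rep a) * Var (rep b))"
      unfolding mk by (simp add: Var_def mult_single ac_simps)
    also have "\<dots> \<in> J"
      using keys_\<pi>[OF m] by (intro J_closed(5) facing_rep_in_J ab) (auto simp: mk keys_nat_add poly_ring_carrier_iff)
    finally show "Poly_Mapping.single m (Poly_Mapping.lookup (\<pi> g) m) \<in> J" .
  qed
  then have "\<pi> g \<in> J" by (simp flip: poly_mapping_sum_single)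
  from J_closed(3)[OF 1 this] show "g \<in> J" by simp
qed (auto dest: J_imp_nonstandard)

end

section \<open>Nonzerodivisors modulo merged variables\<close>

context merging
begin

lemma nonstandard_multE:
  assumes "standard m" "\<not> standard (mvar A + m)"
  obtains p q where "p \<in> C" "q \<in> C" "H p \<union> H q = V" "rep p = A" "Poly_Mapping.lookup m (rep q) \<noteq> 0"
proof -
  obtain a b k where ab: "a \<in> C" "b \<in> C" "H a \<union> H b = V"
    and eq: "mvar A + m = mvar (rep a) + mvar (rep b) + k"
    using assms(2) unfolding standard_def by blast
  consider "rep a = A" | "rep b = A" | "rep a \<noteq> A" "rep b \<noteq> A" by blast
  then show ?thesis
  proof cases
    case 1
    then have "m = mvar (rep b) + k" using eq by (simp add: add.assoc)
    then show ?thesis using that[of a b] ab 1 by (simp add: lookup_add)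
  next
    case 2
    then have "mvar A + m = mvar A + (mvar (rep a) + k)" using eq by (simp add: ac_simps)
    then have "m = mvar (rep a) + k" by (simp only: add_left_cancel)
    then show ?thesis using that[of b a] ab 2 by (simp add: lookup_add Un_commute)
  next
    case 3
    have "Poly_Mapping.lookup (mvar A + m) A \<noteq> 0" by (simp add: lookup_add)
    then have "Poly_Mapping.lookup k A \<noteq> 0"
      unfolding eq using 3 by (simp add: lookup_add lookup_single when_def)
    then obtain k' where "k = mvar A + k'" by (rule mvar_dvd)
    then have "mvar A + m = mvar A + (mvar (rep a) + mvar (rep b) + k')" using eq by (simp add: ac_simps)
    then have "m = mvar (rep a) + mvar (rep b) + k'" by (simp only: add_left_cancel)
    then show ?thesis using assms(1) ab unfolding standard_def by blast
  qed
qed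

text \<open>The combinatorial core. If both products are nonstandard, then \<open>m\<close> contains the classes of a
  \<open>q\<close> facing some \<open>p\<close> in the class of \<open>c\<close> and of a \<open>q2\<close> facing some \<open>p2\<close> in the class of \<open>d\<close>. As
  \<open>p\<close> and \<open>p2\<close> point away from each other, \<open>q\<close> and \<open>q2\<close> face each other. If their classes are
  different, then \<open>m\<close> is nonstandard. If they agree, then \<open>q\<close> and \<open>q2\<close> also point away from each
  other, so \<open>H q\<close> and \<open>H q2\<close> are complementary; this forces \<open>p = q2\<close> and \<open>p2 = q\<close>,
  and the classes of \<open>c\<close> and \<open>d\<close> coincide.\<close>
lemma standard_mult_or:
  assumes X: "outward X" and m: "standard m" and c: "c \<in> C" and d: "d \<in> C" and ne: "rep c \<noteq> rep d"
    and disj: "\<And>p p2. p \<in> C \<Longrightarrow> p2 \<in> C \<Longrightarrow> rep p = rep c \<Longrightarrow> rep p2 = rep d \<Longrightarrow> H p \<inter> H p2 = {}"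
  shows "standard (mvar (rep c) + m) \<or> standard (mvar (rep d) + m)"
proof (rule ccontr)
  assume "\<not> ?thesis"
  then have neg: "\<not> standard (mvar (rep c) + m)" "\<not> standard (mvar (rep d) + m)" by auto
  obtain p q where pq: "p \<in> C" "q \<in> C" "H p \<union> H q = V" "rep p = rep c" "Poly_Mapping.lookup m (rep q) \<noteq> 0"
    using nonstandard_multE[OF m neg(1)] .
  obtain p2 q2 where pq2: "p2 \<in> C" "q2 \<in> C" "H p2 \<union> H q2 = V" "rep p2 = rep d" "Poly_Mapping.lookup m (rep q2) \<noteq> 0"
    using nonstandard_multE[OF m neg(2)] .
  have pp2: "H p \<inter> H p2 = {}" by (rule disj) (use pq pq2 in auto)
  then have qq2: "H q \<union> H q2 = V"
    using pq(3) pq2(3) H_subset[OF pq(2)] H_subset[OF pq2(2)] by blast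
  show False
  proof (cases "rep q = rep q2")
    case True
    have "q \<noteq> q2"
    proof
      assume "q = q2"
      then have "V - H q = {}" using qq2 by simp
      then show False using H_compl[OF pq(2)] H_nonempty by metis
    qed
    moreover have "Var q - Var q2 \<in> mp.span X" using True rep_eq_iff pq(2) pq2(2) by blast
    ultimately have "H q \<inter> H q2 = {}" using X pq(2) pq2(2) unfolding outward_def by blast
    then have "H p = H q2" using pp2 qq2 pq(3) pq2(3) H_subset[OF pq(1)] by blast
    then have "p = q2" using inj_onD[OF inj_H] pq pq2 by blast
    moreover have "H p2 = H q"
    proof
      show "H p2 \<subseteq> H q" using pp2 pq(3) H_subset[OF pq2(1)] by blast
      show "H q \<subseteq> H p2" using \<open>H q \<inter> H q2 = {}\<close> pq2(3) qq2 by blast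
    qed
    then have "p2 = q" using inj_onD[OF inj_H] pq pq2 by blast
    ultimately show False using True ne pq pq2 by simp
  next
    case False
    obtain m' where m': "m = mvar (rep q) + m'" using mvar_dvd[OF pq(5)] .
    then have "Poly_Mapping.lookup m' (rep q2) \<noteq> 0"
      using pq2(5) False by (simp add: lookup_add lookup_single when_def)
    then obtain k where "m' = mvar (rep q2) + k" by (rule mvar_dvd)
    then have "m = mvar (rep q) + mvar (rep q2) + k" using m' by (simp add: add.assoc)
    then show False using m qq2 pq(2) pq2(2) unfolding standard_def by blast
  qed
qed

text \<open>Among \<open>2n\<close> steps, one of the two variables occurs at least \<open>n\<close> times.\<close>
lemma standard_power_or:
  assumes step: "\<And>m. standard m \<Longrightarrow> standard (mvar A + m) \<or> standard (mvar B + m)" and m: "standard m"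
  shows "standard (Poly_Mapping.single A n + m) \<or> standard (Poly_Mapping.single B n + m)"
proof -
  have "\<exists>a b. a + b = l \<and> standard (Poly_Mapping.single A a + Poly_Mapping.single B b + m)" for l
  proof (induction l)
    case 0
    then show ?case using m by auto
  next
    case (Suc l)
    then obtain a b where ab: "a + b = l" "standard (Poly_Mapping.single A a + Poly_Mapping.single B b + m)"
      by blast
    have "mvar A + Poly_Mapping.single A a = Poly_Mapping.single A (Suc a)"
      "mvar B + Poly_Mapping.single B b = Poly_Mapping.single B (Suc b)"
      by (simp_all add: single_add[symmetric])
    then have "standard (Poly_Mapping.single A (Suc a) + Poly_Mapping.single B b + m)
      \<or> standard (Poly_Mapping.single A a + Poly_Mapping.single B (Suc b) + m)"
      using step[OF ab(2)] by (metis (no_types, lifting) add.assoc add.left_commute)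
    then show ?case using ab(1) by (metis add_Suc add_Suc_right)
  qed
  then obtain a b where ab: "a + b = n + n" "standard (Poly_Mapping.single A a + Poly_Mapping.single B b + m)"
    by blast
  have eq: "Poly_Mapping.single x i = Poly_Mapping.single x n + Poly_Mapping.single x (i - n)" if "n \<le> i" for x :: 'x and i
    using that by (simp add: single_add[symmetric])
  consider "n \<le> a" | "n \<le> b" using ab(1) by linarith
  then show ?thesis
  proof cases
    case 1
    from ab(2) eq[OF this, of A] have "standard ((Poly_Mapping.single A n + m) + (Poly_Mapping.single A (a - n) + Poly_Mapping.single B b))"
      by (simp add: ac_simps)
    then show ?thesis using standard_factor by blast
  next
    case 2
    from ab(2) eq[OF this, of B] have "standard ((Poly_Mapping.single B n + m) + (Poly_Mapping.single B (b - n) + Poly_Mapping.single A a))"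
      by (simp add: ac_simps)
    then show ?thesis using standard_factor by blast
  qed
qed

text \<open>If \<open>A h\<close> and \<open>B h\<close> have the same coefficients at standard monomials, then those of \<open>h\<close> at \<open>m\<close> and
  \<open>m A / B\<close> agree as long as \<open>m A\<close> is standard. After more than \<open>deg\<^sub>B m\<close> steps the exponent of \<open>B\<close>
  is exhausted and the coefficient vanishes.\<close>
lemma line_zero:
  fixes h :: "('x, 'k) mpoly"
  assumes "A \<noteq> B"
    and eq: "\<And>m. standard m \<Longrightarrow> Poly_Mapping.lookup (Var A * h) m = Poly_Mapping.lookup (Var B * h) m"
    and "standard (Poly_Mapping.single A n + m)" "Poly_Mapping.lookup m B < n"
  shows "Poly_Mapping.lookup h m = 0"
  using assms(3,4)
proof (induction n arbitrary: m)
  case (Suc n)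
  have An: "Poly_Mapping.single A (Suc n) = mvar A + Poly_Mapping.single A n"
    by (simp add: single_add[symmetric])
  have "standard ((mvar A + m) + Poly_Mapping.single A n)"
    using Suc.prems(1) unfolding An by (simp add: ac_simps)
  then have "standard (mvar A + m)" by (rule standard_factor)
  then have hm: "Poly_Mapping.lookup h m = Poly_Mapping.lookup (Var B * h) (mvar A + m)"
    using eq lookup_Var_mult[of A h m] by metis
  show ?case
  proof (cases "Poly_Mapping.lookup m B = 0")
    case True
    then show ?thesis
      unfolding hm using \<open>A \<noteq> B\<close>
      by (intro lookup_Var_mult_eq_0) (simp add: lookup_add lookup_single when_def)
  next
    case False
    then obtain m' where m': "m = mvar B + m'" by (rule mvar_dvd)
    have "Poly_Mapping.lookup h m = Poly_Mapping.lookup h (mvar A + m')"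
      unfolding hm using lookup_Var_mult[of B h "mvar A + m'"] by (simp add: m' add.left_commute)
    also have "\<dots> = 0"
    proof (rule Suc.IH)
      have "standard ((Poly_Mapping.single A n + (mvar A + m')) + mvar B)"
        using Suc.prems(1) unfolding An m' by (simp add: ac_simps)
      then show "standard (Poly_Mapping.single A n + (mvar A + m'))" by (rule standard_factor)
      show "Poly_Mapping.lookup (mvar A + m') B < n"
        using Suc.prems(2) \<open>A \<noteq> B\<close> unfolding m' by (simp add: lookup_add lookup_single when_def)
    qed
    finally show ?thesis .
  qed
qed simp

lemma outward_imp_nonzerodivisor:
  assumes X: "outward X" and c: "c \<in> C" and d: "d \<in> C" and ne: "rep c \<noteq> rep d"
    and disj: "\<And>p p2. p \<in> C \<Longrightarrow> p2 \<in> C \<Longrightarrow> rep p = rep c \<Longrightarrow> rep p2 = rep d \<Longrightarrow> H p \<inter> H p2 = {}"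
    and g: "g \<in> carrier (poly_ring C)" and J: "(Var c - Var d) * g \<in> J"
  shows "g \<in> J"
  unfolding mem_J_iff[OF g]
proof
  fix m assume m: "m \<in> Poly_Mapping.keys (\<pi> g)"
  have eq: "Poly_Mapping.lookup (Var (rep c) * \<pi> g) m = Poly_Mapping.lookup (Var (rep d) * \<pi> g) m" if "standard m" for m
  proof -
    have "Poly_Mapping.lookup (\<pi> ((Var c - Var d) * g)) m = 0"
      using J_imp_nonstandard[OF J] that by (auto simp: in_keys_iff)
    moreover have "\<pi> ((Var c - Var d) * g) = Var (rep c) * \<pi> g - Var (rep d) * \<pi> g"
      by (simp only: push_push_mult push_diff push_Var left_diff_distrib)
    ultimately show ?thesis by (simp add: lookup_minus)
  qed
  show "\<not> standard m"
  proof
    assume "standard m"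
    \<comment> \<open>The power exceeds both exponents, so that \<open>line_zero\<close> applies in whichever direction is standard.\<close>
    let ?n = "Suc (Poly_Mapping.lookup m (rep c) + Poly_Mapping.lookup m (rep d))"
    have "standard (Poly_Mapping.single (rep c) ?n + m) \<or> standard (Poly_Mapping.single (rep d) ?n + m)"
      by (rule standard_power_or[OF standard_mult_or[OF X _ c d ne disj] \<open>standard m\<close>])
    then have "Poly_Mapping.lookup (\<pi> g) m = 0"
    proof
      assume "standard (Poly_Mapping.single (rep c) ?n + m)"
      from line_zero[OF ne eq this] show ?thesis by simp
    next
      assume "standard (Poly_Mapping.single (rep d) ?n + m)"
      from line_zero[OF ne[symmetric] eq[symmetric] this] show ?thesis by simp
    qed
    then show False using m by (simp add: in_keys_iff)
  qed
qed

lemma standard_mvar: "standard (mvar x)"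
proof -
  have "mvar x \<noteq> mvar a + mvar b + k" for a b k
  proof
    assume eq: "mvar x = mvar a + mvar b + k"
    have a: "a = x" using arg_cong[OF eq, of "\<lambda>m. Poly_Mapping.lookup m a"]
      by (auto simp: lookup_add lookup_single when_def split: if_splits)
    have b: "b = x" using arg_cong[OF eq, of "\<lambda>m. Poly_Mapping.lookup m b"]
      by (auto simp: lookup_add lookup_single when_def split: if_splits)
    show False using arg_cong[OF eq, of "\<lambda>m. Poly_Mapping.lookup m x"] a b by (simp add: lookup_add)
  qed
  then show ?thesis unfolding standard_def by blast
qed

lemma Var_mult_in_J:
  assumes "c \<in> C" "y \<in> C" "p \<in> C" "q \<in> C" "H p \<union> H q = V" "rep p = rep c" "rep q = rep y"
  shows "Var c * Var y \<in> J"
proof -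
  have "\<not> standard (mvar (rep p) + mvar (rep q) + 0)" unfolding standard_def using assms by blast
  moreover have "\<pi> (Var c * Var y) = Poly_Mapping.single (mvar (rep p) + mvar (rep q) + 0) 1"
    unfolding push_push_mult push_Var using assms by (simp add: Var_def mult_single)
  ultimately show ?thesis
    using assms by (simp add: mem_J_iff mult_carrier Var_carrier)
qed

text \<open>Suppose that \<open>H p\<close> and \<open>H p2\<close> meet, and let \<open>H q\<close>, \<open>H q2\<close> be their complements. Then \<open>q q2\<close> is annihilated by the
  classes of \<open>p\<close> and \<open>p2\<close>. If it is itself zero in the quotient, or if \<open>q\<close> and \<open>q2\<close> have the same
  class, then already one of \<open>q\<close>, \<open>q2\<close> is annihilated by both.\<close>
lemma nonzerodivisor_imp_outward:
  assumes X: "outward X" and c: "c \<in> C" and d: "d \<in> C" and ne: "rep c \<noteq> rep d"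
    and nzd: "\<And>g. g \<in> carrier (poly_ring C) \<Longrightarrow> (Var c - Var d) * g \<in> J \<Longrightarrow> g \<in> J"
    and p: "p \<in> C" "rep p = rep c" and p2: "p2 \<in> C" "rep p2 = rep d"
  shows "H p \<inter> H p2 = {}"
proof (rule ccontr)
  assume meet: "H p \<inter> H p2 \<noteq> {}"
  have single: False
    if y: "y \<in> C" "q \<in> C" "q2 \<in> C" "H p \<union> H q = V" "rep q = rep y" "H p2 \<union> H q2 = V" "rep q2 = rep y"
    for y q q2
  proof -
    have "Var c * Var y \<in> J" "Var d * Var y \<in> J"
      using Var_mult_in_J[OF c y(1) p(1) y(2) y(4) p(2) y(5)] Var_mult_in_J[OF d y(1) p2(1) y(3) y(6) p2(2) y(7)] by auto
    then have "(Var c - Var d) * Var y \<in> J" unfolding left_diff_distrib by (rule J_closed(4))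
    then have "Var y \<in> J" using nzd[OF Var_carrier[OF y(1)]] by blast
    then have "\<not> standard (mvar (rep y))" by (rule J_imp_nonstandard) (simp add: push_Var, simp add: Var_def)
    then show False using standard_mvar by blast
  qed
  obtain q where q: "q \<in> C" "H q = V - H p" using H_compl[OF p(1)] by blast
  obtain q2 where q2: "q2 \<in> C" "H q2 = V - H p2" using H_compl[OF p2(1)] by blast
  have pq: "H p \<union> H q = V" "H p2 \<union> H q2 = V" using q q2 H_subset p(1) p2(1) by auto
  show False
  proof (cases "rep q = rep q2")
    case True
    then show False using single[OF q(1) q(1) q2(1) pq(1) refl pq(2)] by simp
  next
    case False
    have "Var c * Var q \<in> J" "Var d * Var q2 \<in> J"
      using Var_mult_in_J[OF c q(1) p(1) q(1) pq(1) p(2) refl]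
        Var_mult_in_J[OF d q2(1) p2(1) q2(1) pq(2) p2(2) refl] by auto
    then have "Var q2 * (Var c * Var q) - Var q * (Var d * Var q2) \<in> J"
      by (rule J_closed(4)[OF J_closed(5)[OF _ Var_carrier[OF q2(1)]] J_closed(5)[OF _ Var_carrier[OF q(1)]]])
    then have "(Var c - Var d) * (Var q * Var q2) \<in> J" by (simp add: algebra_simps)
    then have "Var q * Var q2 \<in> J" using nzd[OF mult_carrier[OF Var_carrier[OF q(1)] Var_carrier[OF q2(1)]]] by blast
    then have "\<not> standard (mvar (rep q) + mvar (rep q2))"
      by (rule J_imp_nonstandard) (simp add: push_push_mult push_Var, simp add: Var_def mult_single)
    then obtain a b where ab: "a \<in> C" "b \<in> C" "H a \<union> H b = V" "rep a = rep q" "rep b = rep q2"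
    proof -
      obtain a b k where ab: "a \<in> C" "b \<in> C" "H a \<union> H b = V"
        and eq: "mvar (rep q) + mvar (rep q2) = mvar (rep a) + mvar (rep b) + k"
        using \<open>\<not> standard _\<close> unfolding standard_def by blast
      have "rep a = rep q \<or> rep a = rep q2" using arg_cong[OF eq, of "\<lambda>m. Poly_Mapping.lookup m (rep a)"]
        by (auto simp: lookup_add lookup_single when_def split: if_splits)
      moreover have "rep b = rep q \<or> rep b = rep q2" using arg_cong[OF eq, of "\<lambda>m. Poly_Mapping.lookup m (rep b)"]
        by (auto simp: lookup_add lookup_single when_def split: if_splits)
      moreover have "rep a \<noteq> rep b" using arg_cong[OF eq, of "\<lambda>m. Poly_Mapping.lookup m (rep a)"] False
        by (auto simp: lookup_add lookup_single when_def split: if_splits)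
      ultimately show ?thesis using that[of a b] that[of b a] ab by (auto simp: Un_commute)
    qed
    have same_rep: "x = y \<or> H x \<inter> H y = {}" if "x \<in> C" "y \<in> C" "rep x = rep y" for x y
      using that X unfolding outward_def by (auto simp: rep_eq_iff)
    show False
    proof (cases "b = q2")
      case True
      show False
      proof (cases "a = q")
        case True
        then show False using \<open>b = q2\<close> ab(3) q q2 meet H_subset[OF p(1)] by blast
      next
        case False
        then have "H a \<subseteq> H p" using same_rep[OF ab(1) q(1) ab(4)] q H_subset[OF ab(1)] by blast
        then have "H p \<union> H b = V" using ab(3) H_subset p(1) ab(2) by blast
        then show False using single[OF q2(1) ab(2) q2(1) _ ab(5) pq(2) refl] by simp
      qed
    next
      case False
      then have "H b \<subseteq> H p2" using same_rep[OF ab(2) q2(1) ab(5)] q2 H_subset[OF ab(2)] by blast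
      then have "H p2 \<union> H a = V" using ab(3) H_subset p2(1) ab(1) by blast
      then show False using single[OF q(1) q(1) ab(1) pq(1) refl _ ab(4)] by simp
    qed
  qed
qed

end

section \<open>Regular linear spaces\<close>

lemma mvar_eq_iff [simp]: "Poly_Mapping.single c (Suc 0) = Poly_Mapping.single d (Suc 0) \<longleftrightarrow> c = d"
proof
  assume "Poly_Mapping.single c (Suc 0) = Poly_Mapping.single d (Suc 0)"
  then have "Poly_Mapping.keys (Poly_Mapping.single c (Suc 0)) = Poly_Mapping.keys (Poly_Mapping.single d (Suc 0))"
    by simp
  then show "c = d" by simp
qed simp

lemma Var_eq_iff [simp]: "Var c = (Var d :: ('x, 'k::field) mpoly) \<longleftrightarrow> c = d"
proof
  assume "Var c = (Var d :: ('x, 'k) mpoly)"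
  then have "Poly_Mapping.keys (Var c :: ('x, 'k) mpoly) = Poly_Mapping.keys (Var d :: ('x, 'k) mpoly)"
    by simp
  then show "c = d" by (simp add: Var_def)
qed simp

lemma lookup_pscale: "Poly_Mapping.lookup (pscale a p) m = a * Poly_Mapping.lookup p m"
  by (auto simp: pscale_def map.rep_eq when_def simp flip: mult_map_scale_conv_mult)

text \<open>The sum of the coefficients of the variables in \<open>S\<close> is a linear functional. It vanishes on
  \<open>X\<close>, hence on its span.\<close>
lemma span_difference_mem_iff:
  fixes X :: "('x, 'k::field) mpoly set"
  assumes "finite C"
    and X: "\<And>f. f \<in> X \<Longrightarrow> \<exists>a\<in>C. \<exists>b\<in>C. f = Var a - Var b \<and> (a \<in> S \<longleftrightarrow> b \<in> S)"
    and c: "c \<in> C" and d: "d \<in> C" and "Var c - Var d \<in> mp.span X"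
  shows "c \<in> S \<longleftrightarrow> d \<in> S"
proof -
  define \<phi> :: "('x, 'k) mpoly \<Rightarrow> 'k" where
    "\<phi> p = (\<Sum>a\<in>S \<inter> C. Poly_Mapping.lookup p (mvar a))" for p
  have Var: "\<phi> (Var a) = (if a \<in> S then 1 else 0)" if "a \<in> C" for a
    using that \<open>finite C\<close> by (simp add: \<phi>_def Var_def lookup_single when_def)
  have add: "\<phi> (p + q) = \<phi> p + \<phi> q" for p q by (simp add: \<phi>_def lookup_add sum.distrib)
  have diff: "\<phi> (p - q) = \<phi> p - \<phi> q" for p q by (simp add: \<phi>_def lookup_minus sum_subtractf)
  have scale: "\<phi> (pscale a p) = a * \<phi> p" for a p
    by (simp add: \<phi>_def lookup_pscale sum_distrib_left)
  have "mp.span X \<subseteq> {p. \<phi> p = 0}"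
  proof (rule mp.span_minimal)
    show "X \<subseteq> {p. \<phi> p = 0}"
    proof
      fix f assume "f \<in> X"
      then obtain a b where "a \<in> C" "b \<in> C" "f = Var a - Var b" "a \<in> S \<longleftrightarrow> b \<in> S" using X by blast
      then show "f \<in> {p. \<phi> p = 0}" by (simp add: diff Var)
    qed
    have "\<phi> 0 = 0" by (simp add: \<phi>_def)
    then show "mp.subspace {p. \<phi> p = 0}" by (simp add: mp.subspace_def add scale)
  qed
  then have "\<phi> (Var c - Var d) = 0" using assms(5) by blast
  then show ?thesis using c d by (simp add: diff Var split: if_splits)
qed

context half_spaces
begin

lemma outward_subset: "outward Y \<Longrightarrow> X \<subseteq> Y \<Longrightarrow> outward X"
  unfolding outward_def using mp.span_mono by blast

lemma outward_empty: "outward {}"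
  unfolding outward_def by simp

end

context merging
begin

text \<open>Adding \<open>Var c - Var d\<close> to \<open>X\<close> merges the classes of \<open>c\<close> and \<open>d\<close> and changes nothing else.\<close>
lemma rep_insert:
  assumes c: "c \<in> C" and d: "d \<in> C" and a: "a \<in> C" and b: "b \<in> C"
    and "Var a - Var b \<in> mp.span (insert (Var c - Var d) X)"
  shows "rep a = rep b \<or> rep a = rep c \<and> rep b = rep d \<or> rep a = rep d \<and> rep b = rep c"
proof -
  have X: "\<exists>x\<in>C. \<exists>y\<in>C. f = Var x - Var y \<and> rep x = rep y" if "f \<in> X" for f
  proof -
    obtain x y where "x \<in> C" "y \<in> C" "f = Var x - Var y"
      using X_diff[OF \<open>f \<in> X\<close>] unfolding variable_difference_def by blast
    then show ?thesis using rep_eq_iff mp.span_base[OF \<open>f \<in> X\<close>] by metis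
  qed
  have *: "a \<in> S \<longleftrightarrow> b \<in> S" if "\<And>x y. rep x = rep y \<Longrightarrow> x \<in> S \<longleftrightarrow> y \<in> S" "c \<in> S \<longleftrightarrow> d \<in> S" for S
  proof (rule span_difference_mem_iff[OF finite_C _ a b assms(5)])
    fix f assume "f \<in> insert (Var c - Var d) X"
    then show "\<exists>x\<in>C. \<exists>y\<in>C. f = Var x - Var y \<and> (x \<in> S \<longleftrightarrow> y \<in> S)"
      using X that c d by (metis insertE)
  qed
  \<comment> \<open>The sets \<open>S\<close> below are unions of classes which do not separate \<open>c\<close> from \<open>d\<close>; the first one is
    admissible if \<open>a\<close> belongs to neither of the two merged classes.\<close>
  show ?thesis
    using *[of "{x. rep x = rep a}"] *[of "{x. rep x = rep c \<or> rep x = rep d}"] by auto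
qed

lemma nonzerodivisor_iff_outward_insert:
  assumes X: "outward X" and c: "c \<in> C" and d: "d \<in> C" and f: "Var c - Var d \<notin> mp.span X"
  shows "nonzerodivisor (poly_ring C Quot J) (J +>\<^bsub>poly_ring C\<^esub> (Var c - Var d)) \<longleftrightarrow>
    outward (insert (Var c - Var d) X)"
proof -
  have ne: "rep c \<noteq> rep d" using f rep_eq_iff[OF c d] by simp
  have "variable_difference C (Var c - Var d :: ('x, 'k) mpoly)"
    unfolding variable_difference_def using ne c d by (intro bexI[of _ c] bexI[of _ d]) auto
  then have carr: "(Var c - Var d :: ('x, 'k) mpoly) \<in> carrier (poly_ring C)"
    by (rule variable_difference_carrier)
  show ?thesis unfolding nonzerodivisor_quotient_iff[OF ideal_J carr]
  proof
    assume nzd: "\<forall>g\<in>carrier (poly_ring C). (Var c - Var d) * g \<in> J \<longrightarrow> g \<in> J"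
    show "outward (insert (Var c - Var d) X)"
      unfolding outward_def
    proof (intro ballI impI)
      fix a b assume ab: "a \<in> C" "b \<in> C" "a \<noteq> b" "Var a - Var b \<in> mp.span (insert (Var c - Var d) X)"
      consider "rep a = rep b" | "rep a = rep c" "rep b = rep d" | "rep a = rep d" "rep b = rep c"
        using rep_insert[OF c d ab(1,2,4)] by blast
      then show "H a \<inter> H b = {}"
      proof cases
        case 1
        then show ?thesis using X ab rep_eq_iff unfolding outward_def by blast
      next
        case 2
        then show ?thesis using nonzerodivisor_imp_outward[OF X c d ne _ ab(1) _ ab(2)] nzd by blast
      next
        case 3
        then show ?thesis using nonzerodivisor_imp_outward[OF X c d ne _ ab(2) _ ab(1)] nzd by blast
      qed
    qed
  next
    assume out: "outward (insert (Var c - Var d) X)"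
    have "H p \<inter> H p2 = {}" if p: "p \<in> C" "p2 \<in> C" "rep p = rep c" "rep p2 = rep d" for p p2
    proof -
      have "Var p - Var c \<in> mp.span X" "Var d - Var p2 \<in> mp.span X"
        using rep_eq_iff p c d by metis+
      then have "Var p - Var c \<in> mp.span (insert (Var c - Var d) X)"
        "Var d - Var p2 \<in> mp.span (insert (Var c - Var d) X)"
        using mp.span_mono[of X "insert (Var c - Var d) X"] by auto
      then have "(Var p - Var c) + ((Var c - Var d) + (Var d - Var p2)) \<in> mp.span (insert (Var c - Var d) X)"
        using mp.span_base[of "Var c - Var d" "insert (Var c - Var d) X"] by (intro mp.span_add) auto
      then have "Var p - Var p2 \<in> mp.span (insert (Var c - Var d) X)" by simp
      moreover have "p \<noteq> p2" using ne p by auto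
      ultimately show ?thesis using out p unfolding outward_def by blast
    qed
    then show "\<forall>g\<in>carrier (poly_ring C). (Var c - Var d) * g \<in> J \<longrightarrow> g \<in> J"
      using outward_imp_nonzerodivisor[OF X c d ne] by blast
  qed
qed

lemma one_notin_J: "1 \<notin> J"
proof
  assume "1 \<in> J"
  then have "\<not> standard 0"
    by (rule J_imp_nonstandard) (simp add: push_def flip: single_one)
  then show False using standard_mvar[of undefined] standard_factor[of 0] by simp
qed

end

context half_spaces
begin

lemma regular_sequence_iff_outward:
  fixes fs :: "('x, 'k::field) mpoly list"
  assumes dist: "distinct fs" and indep: "mp.independent (set fs)"
    and diff: "\<And>f. f \<in> set fs \<Longrightarrow> variable_difference C f"
  shows "regular_sequence (poly_ring C) (Idl\<^bsub>poly_ring C\<^esub> facing_products) fs \<longleftrightarrow> outward (set fs)"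
proof -
  define I :: "('x, 'k) mpoly set" where "I = Idl\<^bsub>poly_ring C\<^esub> facing_products"
  define nzd where "nzd i \<longleftrightarrow> (let J = Idl\<^bsub>poly_ring C\<^esub> (I \<union> set (take i fs))
    in nonzerodivisor (poly_ring C Quot J) (J +>\<^bsub>poly_ring C\<^esub> (fs ! i)))" for i
  have step: "nzd i \<longleftrightarrow> outward (set (take (Suc i) fs))"
    if i: "i < length fs" and out: "outward (set (take i fs))" for i
  proof -
    interpret merging C V H "set (take i fs)"
      by unfold_locales (auto intro: diff dest: in_set_takeD)
    obtain c d where cd: "c \<in> C" "d \<in> C" "fs ! i = Var c - Var d"
      using diff[of "fs ! i"] i unfolding variable_difference_def by auto
    have "fs ! i \<notin> set (take i fs)" using dist i
      by (auto simp: in_set_conv_nth nth_eq_iff_index_eq)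
    then have "set (take i fs) \<subseteq> set fs - {fs ! i}" by (auto dest: in_set_takeD)
    then have "fs ! i \<notin> mp.span (set (take i fs))"
      using indep i mp.span_mono unfolding mp.dependent_def by (meson nth_mem subsetD)
    then show ?thesis
      using nonzerodivisor_iff_outward_insert[OF out cd(1,2)] i
      by (simp add: nzd_def J_def I_def cd(3) take_Suc_conv_app_nth Let_def)
  qed
  have "I \<union> set fs \<subseteq> carrier (poly_ring C)" "Idl\<^bsub>poly_ring C\<^esub> (I \<union> set fs) \<noteq> carrier (poly_ring C)"
  proof -
    interpret merging C V H "set fs" by unfold_locales (rule diff)
    show "I \<union> set fs \<subseteq> carrier (poly_ring C)" using gens_carrier unfolding I_def .
    have "1 \<in> carrier (poly_ring C)" by (simp add: poly_ring_carrier_iff)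
    then show "Idl\<^bsub>poly_ring C\<^esub> (I \<union> set fs) \<noteq> carrier (poly_ring C)"
      using one_notin_J unfolding J_def I_def by metis
  qed
  then have "regular_sequence (poly_ring C) I fs \<longleftrightarrow> (\<forall>i<length fs. nzd i)"
    by (simp add: regular_sequence_def nzd_def)
  also have "\<dots> \<longleftrightarrow> outward (set fs)"
  proof
    assume nzd: "\<forall>i<length fs. nzd i"
    have "i \<le> length fs \<Longrightarrow> outward (set (take i fs))" for i
    proof (induction i)
      case 0
      then show ?case by (simp add: outward_empty)
    next
      case (Suc i)
      then show ?case using step[of i] nzd by simp
    qed
    from this[of "length fs"] show "outward (set fs)" by simp
  next
    assume "outward (set fs)"
    then have "outward (set (take i fs))" for i
      by (rule outward_subset) (auto dest: in_set_takeD)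
    then show "\<forall>i<length fs. nzd i" using step by blast
  qed
  finally show ?thesis unfolding I_def .
qed

lemma finite_variable_differences:
  "finite {f :: ('x, 'k::field) mpoly. variable_difference C f}"
proof (rule finite_subset)
  show "{f. variable_difference C f} \<subseteq> (\<lambda>(c, d). Var c - Var d) ` (C \<times> C)"
    unfolding variable_difference_def by auto
  show "finite ((\<lambda>(c, d). Var c - Var d :: ('x, 'k) mpoly) ` (C \<times> C))"
    using finite_C by simp
qed

lemma outward_span_cong:
  "mp.span X = mp.span Y \<Longrightarrow> outward X \<longleftrightarrow> outward Y"
  by (simp add: outward_def)

theorem regular_linear_space_iff:
  fixes M :: "('x, 'k::field) mpoly set"
  shows "regular_linear_space C (Idl\<^bsub>poly_ring C\<^esub> facing_products) M \<longleftrightarrow>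
    (\<exists>X. (\<forall>f\<in>X. variable_difference C f) \<and> outward X \<and> mp.span X = M)"
proof
  assume "regular_linear_space C (Idl\<^bsub>poly_ring C\<^esub> facing_products) M"
  then obtain fs where fs: "distinct fs" "mp.independent (set fs)" "mp.span (set fs) = M"
    "\<forall>f\<in>set fs. variable_difference C f"
    "regular_sequence (poly_ring C) (Idl\<^bsub>poly_ring C\<^esub> facing_products) fs"
    unfolding regular_linear_space_def by blast
  then have "outward (set fs)" using regular_sequence_iff_outward by blast
  with fs show "\<exists>X. (\<forall>f\<in>X. variable_difference C f) \<and> outward X \<and> mp.span X = M" by blast
next
  assume "\<exists>X. (\<forall>f\<in>X. variable_difference C f) \<and> outward X \<and> mp.span X = M"
  then obtain X where X: "\<forall>f\<in>X. variable_difference C f" "outward X" "mp.span X = M" by blast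
  obtain B where B: "B \<subseteq> X" "mp.independent B" "X \<subseteq> mp.span B"
    using mp.maximal_independent_subset by blast
  have "mp.span B = mp.span X"
    using B mp.span_mono[of B X] mp.span_minimal[OF B(3) mp.subspace_span] by blast
  have "finite B" using finite_subset[OF _ finite_variable_differences] B(1) X(1) by blast
  then obtain fs where fs: "set fs = B" "distinct fs" using finite_distinct_list by blast
  have diff: "\<forall>f\<in>set fs. variable_difference C f" using fs B(1) X(1) by blast
  have "regular_sequence (poly_ring C) (Idl\<^bsub>poly_ring C\<^esub> facing_products) fs"
    using regular_sequence_iff_outward[of fs] fs B(2) diff X(2) outward_span_cong[OF \<open>mp.span B = mp.span X\<close>]
    by blast
  moreover have "M \<subseteq> linear_forms C"
    unfolding linear_forms_def X(3)[symmetric]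
  proof (rule mp.span_minimal[OF _ mp.subspace_span], rule subsetI)
    fix f assume "f \<in> X"
    then obtain c d where "c \<in> C" "d \<in> C" "f = Var c - Var d"
      using X(1) unfolding variable_difference_def by blast
    then show "f \<in> mp.span (Var ` C)" by (auto intro: mp.span_diff mp.span_base)
  qed
  ultimately show "regular_linear_space C (Idl\<^bsub>poly_ring C\<^esub> facing_products) M"
    unfolding regular_linear_space_def
    using fs B(2) diff X(3) \<open>mp.span B = mp.span X\<close> by (metis mp.subspace_span)
qed

end

section \<open>Paths and betweenness in trees\<close>

lemma is_path_refl: "v \<in> V \<Longrightarrow> is_path V E v v [v]"
  by (simp add: is_path_def)

lemma is_path_Cons:
  assumes "is_path V E a w p" "v \<in> V" "v \<notin> set p" "{v, a} \<in> E"
  shows "is_path V E v w (v # p)"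
  using assms by (auto simp: is_path_def successively_Cons)

lemma is_path_ConsD:
  assumes "is_path V E v w (x # p)" "p \<noteq> []"
  shows "x = v" "v \<notin> set p" "{v, hd p} \<in> E" "is_path V E (hd p) w p"
  using assms by (auto simp: is_path_def successively_Cons)

lemma is_path_rev:
  assumes "is_path V E v w p" shows "is_path V E w v (rev p)"
proof -
  have "successively (\<lambda>a b. {b, a} \<in> E) p = successively (\<lambda>a b. {a, b} \<in> E) p"
    by (simp add: insert_commute)
  then show ?thesis
    using assms by (simp add: is_path_def hd_rev last_rev)
qed

lemma is_path_split:
  assumes "is_path V E v w (ps @ u # qs)"
  shows "is_path V E v u (ps @ [u])" "is_path V E u w (u # qs)"
  using assms by (auto simp: is_path_def successively_append_iff successively_Cons hd_append)

lemma path_in_walk: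
  assumes "xs \<noteq> []" "set xs \<subseteq> V" "successively (\<lambda>a b. {a, b} \<in> E) xs"
  shows "\<exists>p. is_path V E (hd xs) (last xs) p \<and> set p \<subseteq> set xs"
  using assms
proof (induction xs)
  case (Cons x xs)
  show ?case
  proof (cases "xs = []")
    case True
    then show ?thesis using Cons.prems is_path_refl[of x V E] by auto
  next
    case False
    then obtain p where p: "is_path V E (hd xs) (last xs) p" "set p \<subseteq> set xs"
      using Cons by (auto simp: successively_Cons)
    show ?thesis
    proof (cases "x \<in> set p")
      case True
      then obtain ps qs where "p = ps @ x # qs" by (meson split_list)
      then have "is_path V E x (last xs) (x # qs)" using is_path_split(2) p(1) by metis
      then show ?thesis using p(2) False \<open>p = ps @ x # qs\<close> by (intro exI[of _ "x # qs"]) auto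
    next
      case x: False
      have "is_path V E x (last xs) (x # p)"
        using Cons.prems False by (intro is_path_Cons[OF p(1) _ x]) (auto simp: successively_Cons)
      then show ?thesis using p(2) False by (intro exI[of _ "x # p"]) auto
    qed
  qed
qed simp

text \<open>Two different paths with the same ends contain a cycle: start where they separate, follow the
  first path up to the first vertex \<open>z\<close> that it shares with the second, and return along the second.\<close>
lemma path_unique:
  assumes "\<not> (\<exists>p. is_cycle V E p)" "is_path V E v w p" "is_path V E v w q"
  shows "p = q"
  using assms(2,3)
proof (induction p arbitrary: v q)
  case Nil
  then show ?case by (simp add: is_path_def)
next
  case (Cons x p)
  obtain y r where q: "q = y # r" using Cons.prems(2) by (cases q) (auto simp: is_path_def)
  have xy: "x = v" "y = v" using Cons.prems unfolding q by (auto simp: is_path_def)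
  show ?case
  proof (cases "p = [] \<or> r = []")
    case True
    then show ?thesis using Cons.prems unfolding q by (auto simp: is_path_def split: if_splits)
  next
    case False
    then have ne: "p \<noteq> []" "r \<noteq> []" by auto
    note p = is_path_ConsD[OF Cons.prems(1) ne(1)]
    note r = is_path_ConsD[OF Cons.prems(2)[unfolded q] ne(2)]
    show ?thesis
    proof (cases "hd p = hd r")
      case True
      then have "p = r" using Cons.IH[OF p(4)] r(4) by simp
      then show ?thesis using q xy by simp
    next
      case neq: False
      have "\<exists>z\<in>set p. z \<in> set r"
        using p(4) r(4) ne unfolding is_path_def by (metis last_in_set)
      then obtain p1 z p2 where z: "p = p1 @ z # p2" "z \<in> set r" "\<forall>t\<in>set p1. t \<notin> set r"
        using split_list_first_prop[of p "\<lambda>z. z \<in> set r"] by blast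
      obtain r1 r2 where r12: "r = r1 @ z # r2" using z(2) by (meson split_list)
      let ?c = "v # p1 @ z # rev r1"
      have "is_path V E v z (v # p1 @ [z])"
        using is_path_split(1)[of V E v w "v # p1" z p2] Cons.prems(1) xy z(1) by simp
      moreover have "is_path V E z (hd r) (z # rev r1)"
        using is_path_rev[OF is_path_split(1)[OF r(4)[unfolded r12]]] r12 by simp
      moreover have "set (v # p1) \<inter> set (z # rev r1) = {}"
        using p(2) r(2) z r12 Cons.prems(1) by (auto simp: is_path_def)
      ultimately have "set ?c \<subseteq> V \<and> distinct ?c \<and> successively (\<lambda>a b. {a, b} \<in> E) ?c \<and> last ?c = hd r"
        unfolding is_path_def by (auto simp: successively_append_iff successively_Cons hd_append)
      moreover have "length ?c \<ge> 3"
        using neq z(1) r12 by (cases p1; cases r1) auto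
      moreover have "{hd r, v} \<in> E" using r(3) by (simp add: insert_commute)
      ultimately have "is_cycle V E ?c" unfolding is_cycle_def by auto
      then show ?thesis using assms(1) by blast
    qed
  qed
qed

locale finite_tree =
  fixes V :: "'v set" and E :: "'v set set"
  assumes tree: "is_tree V E"
begin

abbreviation "P \<equiv> tree_path V E"
abbreviation "B \<equiv> aligned V E"

lemma finite_V: "finite V" using tree by (simp add: is_tree_def)

lemma edgeD: assumes "{v, w} \<in> E" shows "v \<in> V" "w \<in> V" "v \<noteq> w"
proof -
  have "{v, w} \<subseteq> V" "card {v, w} = 2" using tree assms unfolding is_tree_def by auto
  then show "v \<in> V" "w \<in> V" "v \<noteq> w" by auto
qed

lemma path_eq: "is_path V E v w p \<Longrightarrow> P v w = p"
  unfolding tree_path_def using tree path_unique[of V E v w]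
  by (intro the_equality) (auto simp: is_tree_def)

lemma path: assumes "v \<in> V" "w \<in> V" shows "is_path V E v w (P v w)"
proof -
  obtain p where "is_path V E v w p" using tree assms unfolding is_tree_def by blast
  then show ?thesis using path_eq by metis
qed

lemma aligned_in: "v \<in> V \<Longrightarrow> w \<in> V \<Longrightarrow> B v u w \<Longrightarrow> u \<in> V"
  using path[of v w] unfolding aligned_def is_path_def by blast

lemma aligned_ends: 
  assumes "v \<in> V" "w \<in> V" shows "B v v w" "B v w w"
  using path[OF assms] unfolding aligned_def is_path_def by (metis hd_in_set, metis last_in_set)

lemma path_rev: "v \<in> V \<Longrightarrow> w \<in> V \<Longrightarrow> P w v = rev (P v w)"
  by (rule path_eq[OF is_path_rev[OF path]])

lemma aligned_sym: "v \<in> V \<Longrightarrow> w \<in> V \<Longrightarrow> B v u w \<Longrightarrow> B w u v"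
  by (simp add: aligned_def path_rev[of v w])

lemma path_split:
  assumes "v \<in> V" "w \<in> V" "B v u w"
  obtains ps qs where "P v w = ps @ u # qs" "P v u = ps @ [u]" "P u w = u # qs"
proof -
  obtain ps qs where eq: "P v w = ps @ u # qs" using assms(3) unfolding aligned_def by (meson split_list)
  show ?thesis using that[OF eq] path[OF assms(1,2)] is_path_split[of V E v w ps u qs] path_eq eq by metis
qed

lemma aligned_antisym:
  assumes "v \<in> V" "w \<in> V" "u \<in> V" "B v u w" "B v w u"
  shows "u = w"
proof -
  obtain ps qs where eq: "P v w = ps @ u # qs" "P v u = ps @ [u]"
    using path_split[OF assms(1,2,4)] by blast
  show ?thesis
  proof (cases "qs = []")
    case True
    then show ?thesis using path[OF assms(1,2)] eq by (simp add: is_path_def)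
  next
    case False
    then have "w \<in> set qs" using path[OF assms(1,2)] eq by (auto simp: is_path_def)
    moreover have "w \<in> set (ps @ [u])" using assms(5) eq by (simp add: aligned_def)
    ultimately show ?thesis using path[OF assms(1,2)] eq by (auto simp: is_path_def)
  qed
qed

text \<open>The path from \<open>v\<close> to \<open>w\<close> is contained in the walk from \<open>v\<close> to \<open>u\<close> and on to \<open>w\<close>. Together with
  antisymmetry this is all that is needed to reason about betweenness in a tree.\<close>
lemma aligned_split:
  assumes "v \<in> V" "w \<in> V" "u \<in> V" "B v x w"
  shows "B v x u \<or> B u x w"
proof -
  have p: "is_path V E v u (P v u)" and q: "is_path V E u w (P u w)" using path assms by auto
  let ?xs = "P v u @ tl (P u w)"
  obtain q' where q': "P u w = u # q'" using q by (cases "P u w") (auto simp: is_path_def)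
  have "\<exists>r. is_path V E (hd ?xs) (last ?xs) r \<and> set r \<subseteq> set ?xs"
    using p q by (intro path_in_walk) (auto simp: q' is_path_def successively_append_iff successively_Cons)
  moreover have "hd ?xs = v" "last ?xs = w" using p q by (auto simp: q' is_path_def split: if_splits)
  ultimately obtain r where "is_path V E v w r" "set r \<subseteq> set ?xs" by auto
  then show ?thesis using assms(4) path_eq by (auto simp: aligned_def q')
qed

lemma aligned_edge:
  assumes "{v, w} \<in> E" shows "B v x w \<longleftrightarrow> x = v \<or> x = w"
proof -
  have "is_path V E v w [v, w]" using edgeD[OF assms] assms by (simp add: is_path_def)
  then show ?thesis by (auto simp: aligned_def path_eq)
qed

lemma aligned_edge_or:
  assumes "{v, w} \<in> E" "r \<in> V" shows "B v w r \<or> B w v r"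
proof (cases "w \<in> set (P v r)")
  case False
  have "is_path V E w r (w # P v r)"
    using edgeD[OF assms(1)] assms False by (intro is_path_Cons[OF path]) (auto simp: insert_commute)
  then show ?thesis using aligned_ends(1) edgeD(1)[OF assms(1)] assms(2) by (auto simp: aligned_def path_eq)
qed (simp add: aligned_def)

text \<open>For \<open>v \<noteq> w\<close>, the neighbour of \<open>v\<close> in the direction of \<open>w\<close>.\<close>
abbreviation "nbr \<equiv> nbr_first V E"

lemma nbr:
  assumes "v \<in> V" "w \<in> V" "v \<noteq> w"
  shows "{v, nbr v w} \<in> E" "B v (nbr v w) w"
proof -
  have p: "is_path V E v w (P v w)" using path assms by auto
  obtain q where q: "P v w = v # q" using p by (cases "P v w") (auto simp: is_path_def)
  then have "q \<noteq> []" using p assms(3) by (auto simp: is_path_def)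
  then show "{v, nbr v w} \<in> E" "B v (nbr v w) w"
    using is_path_ConsD(3)[OF p[unfolded q]] q by (auto simp: nbr_first_def aligned_def)
qed

lemma nbr_last_eq:
  assumes "v \<in> V" "w \<in> V" "v \<noteq> w" shows "nbr_last V E v w = nbr w v"
  using path_rev[OF assms(1,2)]
  by (simp add: nbr_last_def nbr_first_def last_conv_nth hd_conv_nth)
   (metis butlast_rev hd_rev rev_rev_ident)

lemma aligned_trans:
  assumes "v \<in> V" "w \<in> V" "B v u w" "B v x u" shows "B v x w" "B x u w"
proof -
  have u: "u \<in> V" using assms aligned_in by blast
  have x: "x \<in> V" using assms u aligned_in by blast
  show "B v x w"
    using aligned_split[OF assms(1) u assms(2) assms(4)] aligned_split[OF assms(1,2) x assms(3)]
      aligned_antisym aligned_sym assms u x by metis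
  show "B x u w"
    using aligned_split[OF assms(1,2) x assms(3)] aligned_antisym[OF assms(1) u x] aligned_ends u x assms by metis
qed

text \<open>A sequence of vertices that does not turn back locally does not turn back at all.\<close>
lemma aligned_extend:
  assumes "v \<in> V" "u \<in> V" "w \<in> V" "x \<in> V" "B v u w" "B u w x" "u \<noteq> w"
  shows "B v w x" "B v u x"
proof -
  show 1: "B v w x"
    using aligned_split[OF assms(2,4,1,6)] aligned_antisym[OF assms(1,3,2,5)] aligned_sym assms by metis
  show "B v u x" using aligned_trans(1)[OF assms(1,4) 1 assms(5)] .
qed

lemma aligned_self: "v \<in> V \<Longrightarrow> B v u v \<Longrightarrow> u = v"
  using aligned_antisym[of v v u] aligned_ends aligned_in by metis

lemma nbr_unique:
  assumes "{v, a} \<in> E" "B v a w" "w \<in> V" shows "v \<noteq> w" "nbr v w = a"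
proof -
  note v = edgeD[OF assms(1)]
  show ne: "v \<noteq> w" using aligned_self v assms by metis
  note n = nbr[OF v(1) assms(3) ne]
  have n_V: "nbr v w \<in> V" using edgeD n by blast
  show "nbr v w = a"
  proof (rule ccontr)
    assume neq: "nbr v w \<noteq> a"
    have "B (nbr v w) a w"
      using aligned_split[OF v(1) assms(3) n_V assms(2)] aligned_edge[OF n(1), of a] neq v by auto
    moreover have "B a (nbr v w) w"
      using aligned_split[OF v(1) assms(3) v(2) n(2)] aligned_edge[OF assms(1), of "nbr v w"] neq edgeD(3)[OF n(1)] by auto
    ultimately show False using aligned_antisym[of w a "nbr v w"] aligned_sym v(2) n_V assms(3) neq by metis
  qed
qed

lemma nbr_eq_iff:
  assumes "v \<in> V" "w \<in> V" "u \<in> V" "v \<noteq> w" "v \<noteq> u"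
  shows "nbr v w = nbr v u \<longleftrightarrow> \<not> B w v u"
proof
  note n = nbr[OF assms(1,2,4)]
  have n_V: "nbr v w \<in> V" "nbr v w \<noteq> v" using edgeD[OF n(1)] by auto
  assume "nbr v w = nbr v u"
  then have nu: "B v (nbr v w) u" using nbr[OF assms(1,3,5)] by simp
  show "\<not> B w v u"
  proof
    assume "B w v u"
    then have "B (nbr v w) v u"
      using aligned_trans(2)[OF assms(2,3), of v "nbr v w"] aligned_sym[OF assms(1,2) n(2)] by blast
    then show False using nu aligned_antisym[of u v "nbr v w"] aligned_sym n_V assms by metis
  qed
next
  note n = nbr[OF assms(1,2,4)]
  have n_V: "nbr v w \<in> V" using edgeD[OF n(1)] by auto
  assume not: "\<not> B w v u"
  have "B v (nbr v w) u"
  proof (rule ccontr)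
    assume "\<not> ?thesis"
    then have "B (nbr v w) v u" using aligned_edge_or[OF n(1) assms(3)] by blast
    then have "B w v u"
      using aligned_extend(1)[of w "nbr v w" v u] aligned_sym[OF assms(1,2) n(2)] edgeD[OF n(1)] assms by auto
    then show False using not by blast
  qed
  then show "nbr v w = nbr v u" using nbr_unique(2)[OF n(1)] assms by simp
qed

end

section \<open>Half-trees and the tree ideal\<close>

context finite_tree
begin

text \<open>The vertices towards which the edge \<open>fst c\<close>, directed away from its end \<open>snd c\<close>, points.\<close>
definition half :: "'v set \<times> 'v \<Rightarrow> 'v set" where
  "half c = {r \<in> V. \<exists>a. fst c = {snd c, a} \<and> a \<noteq> snd c \<and> B (snd c) a r}"

lemma half_edge: "{v, a} \<in> E \<Longrightarrow> half ({v, a}, v) = {r \<in> V. B v a r}"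
  using edgeD[of v a] by (auto simp: half_def doubleton_eq_iff)

lemma incidenceE:
  assumes "c \<in> incidence V E" obtains v a where "c = ({v, a}, v)" "{v, a} \<in> E"
proof -
  obtain e v where c: "c = (e, v)" "e \<in> E" "v \<in> e" using assms by (auto simp: incidence_def)
  have "card e = 2" using c tree by (simp add: is_tree_def)
  then obtain a where "e = {v, a}" using c(3) by (auto simp: card_2_iff)
  then show ?thesis using that c by blast
qed

lemma incidenceI: "{v, a} \<in> E \<Longrightarrow> ({v, a}, v) \<in> incidence V E"
  using edgeD[of v a] by (auto simp: incidence_def)

lemma aligned_edge_not_both:
  assumes "{v, a} \<in> E" "r \<in> V" "B v a r" shows "\<not> B a v r"
  using aligned_antisym[of r a v] aligned_sym edgeD[OF assms(1)] assms by metis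

lemma half_compl: "{v, a} \<in> E \<Longrightarrow> half ({a, v}, a) = V - half ({v, a}, v)"
  using aligned_edge_or[of v a] aligned_edge_not_both[of v a] half_edge[of v a] half_edge[of a v]
  by (auto simp: insert_commute)

lemma half_Un_iff:
  assumes "{v, a} \<in> E" "{w, b} \<in> E"
  shows "half ({v, a}, v) \<union> half ({w, b}, w) = V \<longleftrightarrow> v \<noteq> w \<and> a = nbr v w \<and> b = nbr w v"
proof
  note v = edgeD[OF assms(1)] and w = edgeD[OF assms(2)]
  assume "half ({v, a}, v) \<union> half ({w, b}, w) = V"
  then have cover: "B v a r \<or> B w b r" if "r \<in> V" for r
    using that half_edge assms by blast
  have "B w b v" "B v a w" using cover[of v] cover[of w] v w aligned_self by metis+
  then show "v \<noteq> w \<and> a = nbr v w \<and> b = nbr w v"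
    using nbr_unique[OF assms(1) _ w(1)] nbr_unique[OF assms(2) _ v(1)] by auto
next
  note v = edgeD[OF assms(1)] and w = edgeD[OF assms(2)]
  assume R: "v \<noteq> w \<and> a = nbr v w \<and> b = nbr w v"
  have "B v a r \<or> B w b r" if r: "r \<in> V" for r
  proof (cases "B v a r")
    case False
    then have "B a v r" using aligned_edge_or[OF assms(1) r] by blast
    moreover have "B w a v" using nbr(2)[of v w] R v w aligned_sym by metis
    ultimately have "B w v r" using aligned_extend(1)[of w a v r] v w r by blast
    then show ?thesis using aligned_trans(1)[of w r v b] nbr(2)[of w v] R v w r by metis
  qed simp
  then show "half ({v, a}, v) \<union> half ({w, b}, w) = V" using half_edge assms by blast
qed

sublocale half_spaces "incidence V E" V half
proof
  have "incidence V E \<subseteq> Pow V \<times> V" using tree by (auto simp: incidence_def is_tree_def)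
  then show "finite (incidence V E)" using finite_V finite_subset by blast
next
  fix c assume "c \<in> incidence V E"
  then obtain v a where c: "c = ({v, a}, v)" "{v, a} \<in> E" by (rule incidenceE)
  show "half c \<subseteq> V" by (auto simp: half_def)
  show "half c \<noteq> {}" using half_edge[OF c(2)] edgeD[OF c(2)] aligned_ends(2) unfolding c by blast
  have "({a, v}, a) \<in> incidence V E" using c(2) incidenceI[of a v] by (simp add: insert_commute)
  then show "\<exists>d\<in>incidence V E. half d = V - half c" using half_compl[OF c(2)] unfolding c by blast
next
  show "inj_on half (incidence V E)"
  proof (rule inj_onI)
    fix c d assume "c \<in> incidence V E" "d \<in> incidence V E" and eq: "half c = half d"
    then obtain v a w b where c: "c = ({v, a}, v)" "{v, a} \<in> E" and d: "d = ({w, b}, w)" "{w, b} \<in> E"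
      by (metis incidenceE)
    have c': "{a, v} \<in> E" and d': "{b, w} \<in> E" using c d by (simp_all add: insert_commute)
    have "half ({v, a}, v) \<union> half ({b, w}, b) = V" "half ({w, b}, w) \<union> half ({a, v}, a) = V"
      using half_compl[OF c(2)] half_compl[OF d(2)] eq unfolding c d by (auto simp: half_def)
    then have 1: "v \<noteq> b" "a = nbr v b" "w = nbr b v" "w \<noteq> a" "b = nbr w a" "v = nbr a w"
      using half_Un_iff[OF c(2) d'] half_Un_iff[OF d(2) c'] by auto
    note V = edgeD[OF c(2)] edgeD[OF d(2)]
    have al: "B v a b" "B b w v" "B w b a" "B a v w"
      using nbr(2)[OF V(1,5) 1(1)] nbr(2)[OF V(5,1) 1(1)[symmetric]]
        nbr(2)[OF V(4,2) 1(4)] nbr(2)[OF V(2,4) 1(4)[symmetric]]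
      by (simp_all only: 1(2,3,5,6)[symmetric])
    have "B w v a" by (rule aligned_sym[OF V(2,4) al(4)])
    then have "B w a b" using aligned_extend(1)[of w v a b] al(1) V by blast
    then have "a = b" using aligned_antisym[of w a b] al(3) V by blast
    moreover have "v = w"
      using nbr_unique(2)[OF c' aligned_ends(2)[OF V(2,1)] V(1)] 1(3) \<open>a = b\<close> by simp
    ultimately show "c = d" using c d by simp
  qed
qed

text \<open>The variable of the edge at \<open>v\<close> in direction of \<open>w\<close>, directed towards \<open>v\<close> and so away from \<open>w\<close>.
  Thus \<open>h\<^sub>v\<^sub>,\<^sub>w\<close> is the difference of \<open>arc v w\<close> and \<open>arc w v\<close>.\<close>
definition arc :: "'v \<Rightarrow> 'v \<Rightarrow> 'v set \<times> 'v" where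
  "arc v w = ({v, nbr v w}, nbr v w)"

lemma arc_in: "v \<in> V \<Longrightarrow> w \<in> V \<Longrightarrow> v \<noteq> w \<Longrightarrow> arc v w \<in> incidence V E"
  using nbr(1)[of v w] incidenceI[of "nbr v w" v] by (simp add: arc_def insert_commute)

lemma arc_eq_iff:
  assumes "v \<in> V" "w \<in> V" "v \<noteq> w" "x \<in> V" "y \<in> V" "x \<noteq> y"
  shows "arc v w = arc x y \<longleftrightarrow> v = x \<and> nbr v w = nbr x y"
  using edgeD(3)[OF nbr(1)[OF assms(1-3)]] edgeD(3)[OF nbr(1)[OF assms(4-6)]]
  by (auto simp: arc_def doubleton_eq_iff)

lemma half_disjoint_iff:
  assumes c: "c \<in> incidence V E" and d: "d \<in> incidence V E"
  shows "half c \<inter> half d = {} \<longleftrightarrow> (\<exists>v\<in>V. \<exists>w\<in>V. v \<noteq> w \<and> c = arc v w \<and> d = arc w v)"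
proof -
  obtain a v where c: "c = ({a, v}, a)" "{a, v} \<in> E" using c by (rule incidenceE)
  obtain b w where d: "d = ({b, w}, b)" "{b, w} \<in> E" using d by (rule incidenceE)
  have c': "{v, a} \<in> E" and d': "{w, b} \<in> E" using c d by (simp_all add: insert_commute)
  note V = edgeD[OF c'] edgeD[OF d']
  have "half c \<inter> half d = {} \<longleftrightarrow> half ({v, a}, v) \<union> half ({w, b}, w) = V"
    using half_compl[OF c'] half_compl[OF d'] H_subset[OF incidenceI[OF c']] H_subset[OF incidenceI[OF d']]
    unfolding c d by auto
  also have "\<dots> \<longleftrightarrow> v \<noteq> w \<and> a = nbr v w \<and> b = nbr w v" by (rule half_Un_iff[OF c' d'])
  also have "\<dots> \<longleftrightarrow> (\<exists>x\<in>V. \<exists>y\<in>V. x \<noteq> y \<and> c = arc x y \<and> d = arc y x)"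
  proof
    assume "v \<noteq> w \<and> a = nbr v w \<and> b = nbr w v"
    then show "\<exists>x\<in>V. \<exists>y\<in>V. x \<noteq> y \<and> c = arc x y \<and> d = arc y x"
      using V by (intro bexI[of _ v] bexI[of _ w]) (auto simp: c d arc_def insert_commute)
  next
    assume "\<exists>x\<in>V. \<exists>y\<in>V. x \<noteq> y \<and> c = arc x y \<and> d = arc y x"
    then obtain x y where xy: "x \<in> V" "y \<in> V" "x \<noteq> y" "c = arc x y" "d = arc y x" by blast
    have "v = x \<and> a = nbr x y" "w = y \<and> b = nbr y x"
      using xy(4,5) V by (auto simp: c d arc_def doubleton_eq_iff)
    then show "v \<noteq> w \<and> a = nbr v w \<and> b = nbr w v" using xy by auto
  qed
  finally show ?thesis .
qed

lemma tree_diff_eq: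
  assumes "v \<in> V" "w \<in> V" "v \<noteq> w"
  shows "tree_diff V E v w = Var (arc v w) - Var (arc w v)"
  using nbr_last_eq[OF assms] by (simp add: tree_diff_def arc_def Let_def)

lemma tree_ideal_eq:
  "tree_ideal V E = Idl\<^bsub>poly_ring (incidence V E)\<^esub> (facing_products :: ('v set \<times> 'v, 'k::field) mpoly set)"
proof -
  have "{tree_monomial V E v w | v w. v \<in> V \<and> w \<in> V \<and> v \<noteq> w} = (facing_products :: ('v set \<times> 'v, 'k) mpoly set)"
    (is "?M = _")
  proof
    show "?M \<subseteq> facing_products"
    proof
      fix f assume "f \<in> ?M"
      then obtain v w where vw: "v \<in> V" "w \<in> V" "v \<noteq> w" and f: "f = tree_monomial V E v w" by blast
      have e: "{v, nbr v w} \<in> E" "{w, nbr w v} \<in> E" using nbr vw by auto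
      have "half ({v, nbr v w}, v) \<union> half ({w, nbr w v}, w) = V" using half_Un_iff[OF e] vw by simp
      moreover have "f = Var ({v, nbr v w}, v) * Var ({w, nbr w v}, w)"
        using f nbr_last_eq[OF vw] by (simp add: tree_monomial_def Let_def)
      ultimately show "f \<in> facing_products"
        unfolding facing_products_def using incidenceI[OF e(1)] incidenceI[OF e(2)] by blast
    qed
    show "facing_products \<subseteq> ?M"
    proof
      fix f :: "('v set \<times> 'v, 'k) mpoly" assume "f \<in> facing_products"
      then obtain c d where c: "c \<in> incidence V E" and d: "d \<in> incidence V E"
        and cover: "half c \<union> half d = V" and f: "f = Var c * Var d"
        unfolding facing_products_def by blast
      obtain v a where c: "c = ({v, a}, v)" "{v, a} \<in> E" using c by (rule incidenceE)
      obtain w b where d: "d = ({w, b}, w)" "{w, b} \<in> E" using d by (rule incidenceE)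
      have vw: "v \<noteq> w" "a = nbr v w" "b = nbr w v" using half_Un_iff[OF c(2) d(2)] cover c d by auto
      have V: "v \<in> V" "w \<in> V" using edgeD c d by auto
      have "f = tree_monomial V E v w"
        using f nbr_last_eq[OF V vw(1)] vw by (simp add: tree_monomial_def Let_def c d)
      then show "f \<in> ?M" using V vw(1) by blast
    qed
  qed
  then show ?thesis by (simp add: tree_ideal_def)
qed

lemma card_interval_less:
  assumes "v \<in> V" "w \<in> V" "B v u w" "u \<noteq> w"
  shows "card {x \<in> V. B v x u} < card {x \<in> V. B v x w}"
proof (rule psubset_card_mono)
  show "finite {x \<in> V. B v x w}" using finite_V by simp
  have "w \<notin> {x \<in> V. B v x u}" using aligned_antisym[of v w u] aligned_in assms by blast
  moreover have "w \<in> {x \<in> V. B v x w}" using aligned_ends assms by blast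
  ultimately show "{x \<in> V. B v x u} \<subset> {x \<in> V. B v x w}"
    using aligned_trans(1)[OF assms(1-3)] by blast
qed

end

section \<open>Flowing trees and the space of a vertex set\<close>

lemma is_tree_singleton: "is_tree {u} {}"
proof -
  have "\<not> is_cycle {u} {} p" for p :: "'a list" by (simp add: is_cycle_def)
  moreover have "is_path {u} {} u u [u]" by (simp add: is_path_def)
  ultimately show ?thesis unfolding is_tree_def by blast
qed

lemma is_path_mono:
  assumes "is_path U S v w p" "U \<subseteq> U'" "S \<subseteq> S'" shows "is_path U' S' v w p"
proof -
  have "successively (\<lambda>a b. {a, b} \<in> S') p"
    using assms(1,3) by (auto simp: is_path_def elim: successively_mono)
  then show ?thesis using assms(1,2) by (auto simp: is_path_def)
qed

lemma hd_neq_last: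
  assumes "distinct xs" "2 \<le> length xs" shows "hd xs \<noteq> last xs"
proof (cases xs)
  case (Cons x ys)
  then have "last xs \<in> set ys" using assms(2) by auto
  then show ?thesis using assms(1) Cons by auto
qed (use assms in simp)

lemma is_tree_add_leaf:
  assumes tree: "is_tree U S" and p: "p \<in> U" and u: "u \<notin> U"
  shows "is_tree (insert u U) (insert {u, p} S)"
proof -
  let ?U = "insert u U" and ?S = "insert {u, p} S"
  interpret finite_tree U S by unfold_locales (rule tree)
  have old: "is_path ?U ?S v w (P v w)" if "v \<in> U" "w \<in> U" for v w
    using is_path_mono[OF path[OF that]] by blast
  have new: "is_path ?U ?S u w (u # P p w)" if "w \<in> U" for w
    using old[OF p that] u path[OF p that] by (intro is_path_Cons) (auto simp: is_path_def)
  have "\<exists>q. is_path ?U ?S v w q" if "v \<in> ?U" "w \<in> ?U" for v w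
    using that old new is_path_rev[OF new] is_path_refl[of u ?U ?S] by (metis insertE insertI1)
  moreover have "\<not> is_cycle ?U ?S c" for c
  proof
    assume cyc: "is_cycle ?U ?S c"
    have leaf: "x = p" if "{u, x} \<in> ?S" for x
      using that edgeD(1)[of u x] u by (auto simp: doubleton_eq_iff)
    show False
    proof (cases "u \<in> set c")
      case True
      then obtain ps qs where c: "c = ps @ u # qs" by (meson split_list)
      have succ: "hd qs = p" if "qs \<noteq> []"
        using that cyc leaf by (auto simp: is_cycle_def c successively_append_iff successively_Cons)
      have pred: "last ps = p" if "ps \<noteq> []"
        using that cyc leaf[of "last ps"]
        by (auto simp: is_cycle_def c successively_append_iff successively_Cons insert_commute)
      consider "ps = []" | "qs = []" | "ps \<noteq> []" "qs \<noteq> []" by blast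
      then show False
      proof cases
        case 1
        then have "last qs = p" "2 \<le> length qs" "distinct qs"
          using cyc leaf[of "last qs"] by (auto simp: is_cycle_def c insert_commute split: if_splits)
        moreover have "hd qs = p" using \<open>2 \<le> length qs\<close> by (intro succ) auto
        ultimately show False using hd_neq_last[of qs] by simp
      next
        case 2
        then have "hd ps = p" "2 \<le> length ps" "distinct ps"
          using cyc leaf[of "hd ps"] by (auto simp: is_cycle_def c hd_append split: if_splits)
        moreover have "last ps = p" using \<open>2 \<le> length ps\<close> by (intro pred) auto
        ultimately show False using hd_neq_last[of ps] by simp
      next
        case 3
        then show False
          using succ pred cyc hd_in_set[of qs] last_in_set[of ps] by (auto simp: is_cycle_def c)
      qed
    next
      case False
      have edge: "{a, b} \<in> S" if "{a, b} \<in> ?S" "a \<in> set c" "b \<in> set c" for a b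
        using that False by (auto simp: doubleton_eq_iff)
      have "successively (\<lambda>a b. {a, b} \<in> S) c"
        using cyc edge unfolding is_cycle_def by (auto elim!: successively_mono)
      moreover have "{last c, hd c} \<in> S"
        using cyc by (intro edge hd_in_set last_in_set) (auto simp: is_cycle_def)
      ultimately have "is_cycle U S c" using cyc False by (auto simp: is_cycle_def)
      then show False using tree by (auto simp: is_tree_def)
    qed
  qed
  moreover have "u \<noteq> p" using p u by auto
  then have "card {u, p} = 2" by simp
  ultimately show ?thesis using tree p unfolding is_tree_def by auto
qed

lemma aligned_add_leaf:
  assumes tree: "is_tree U S" and p: "p \<in> U" and u: "u \<notin> U"
  shows "v \<in> U \<Longrightarrow> w \<in> U \<Longrightarrow> aligned (insert u U) (insert {u, p} S) v x w \<longleftrightarrow> aligned U S v x w"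
    and "w \<in> U \<Longrightarrow> aligned (insert u U) (insert {u, p} S) u x w \<longleftrightarrow> x = u \<or> aligned U S p x w"
proof -
  let ?U = "insert u U" and ?S = "insert {u, p} S"
  interpret finite_tree U S by unfold_locales (rule tree)
  interpret T': finite_tree ?U ?S by unfold_locales (rule is_tree_add_leaf[OF assms])
  have old: "is_path ?U ?S v w (P v w)" if "v \<in> U" "w \<in> U" for v w
    using is_path_mono[OF path[OF that]] by blast
  then show "aligned ?U ?S v x w \<longleftrightarrow> aligned U S v x w" if "v \<in> U" "w \<in> U"
    using T'.path_eq[OF old[OF that]] by (simp add: aligned_def)
  show "aligned ?U ?S u x w \<longleftrightarrow> x = u \<or> aligned U S p x w" if "w \<in> U"
  proof -
    have "is_path ?U ?S u w (u # P p w)"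
      using old[OF p that] u path[OF p that] by (intro is_path_Cons) (auto simp: is_path_def)
    then show ?thesis by (simp add: aligned_def T'.path_eq)
  qed
qed

context finite_tree
begin

text \<open>A vertex of \<open>U\<close> at maximal distance from a fixed \<open>r \<in> U\<close> does not lie between two others.\<close>
lemma exists_not_between:
  assumes "U \<subseteq> V" "U \<noteq> {}"
  obtains u where "u \<in> U" "\<And>a b. a \<in> U \<Longrightarrow> b \<in> U \<Longrightarrow> B a u b \<Longrightarrow> u = a \<or> u = b"
proof -
  obtain r where r: "r \<in> U" using assms by blast
  define d where "d u = card {x \<in> V. B r x u}" for u
  have "finite U" using assms finite_V finite_subset by blast
  then have "Max (d ` U) \<in> d ` U" using assms(2) by (intro Max_in) auto
  then obtain u where "Max (d ` U) = d u" "u \<in> U" by (rule imageE)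
  moreover have "d x \<le> Max (d ` U)" if "x \<in> U" for x using that \<open>finite U\<close> by simp
  ultimately have u: "u \<in> U" "\<And>x. x \<in> U \<Longrightarrow> d x \<le> d u" by auto
  have far: "u = b" if "b \<in> U" "B r u b" for b
    using card_interval_less[of r b u] u(2)[OF that(1)] that r assms(1) unfolding d_def by fastforce
  have "u = a \<or> u = b" if "a \<in> U" "b \<in> U" "B a u b" for a b
    using aligned_split[of a b r u] that r assms(1) far aligned_sym[of a r u] by blast
  then show ?thesis using that u(1) by blast
qed

text \<open>Remove a vertex \<open>u\<close> which does not lie between two others, and attach it to a tree on the
  remaining vertices as a leaf, at a vertex \<open>p\<close> closest to \<open>u\<close>.\<close>
lemma exists_flowing_tree:
  assumes "U \<subseteq> V" "U \<noteq> {}"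
  shows "\<exists>S. is_tree U S \<and> flows_with U S V E"
  using assms
proof (induction "card U" arbitrary: U rule: less_induct)
  case less
  have fin: "finite U" using less.prems finite_V finite_subset by blast
  obtain u where u: "u \<in> U" and between: "\<And>a b. a \<in> U \<Longrightarrow> b \<in> U \<Longrightarrow> B a u b \<Longrightarrow> u = a \<or> u = b"
    using exists_not_between less.prems by blast
  let ?W = "U - {u}"
  show ?case
  proof (cases "?W = {}")
    case True
    then have U: "U = {u}" using u by blast
    interpret S: finite_tree "{u}" "{}" by unfold_locales (rule is_tree_singleton)
    have "flows_with {u} {} V E" using S.aligned_ends(1) unfolding flows_with_def by simp
    then show ?thesis unfolding U using is_tree_singleton[of u] by (intro exI[of _ "{}"] conjI)
  next
    case False
    have "card ?W < card U" by (rule card_Diff1_less[OF fin u])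
    then obtain S where S: "is_tree ?W S" "flows_with ?W S V E"
      using less.hyps[of ?W] less.prems False by blast
    define d where "d x = card {y \<in> V. B u y x}" for x
    obtain p where p: "p \<in> ?W" "\<And>x. x \<in> ?W \<Longrightarrow> d p \<le> d x"
      using ex_is_arg_min_if_finite[of ?W d] False fin by (auto simp: is_arg_min_linorder)
    let ?S = "insert {u, p} S"
    have U: "insert u ?W = U" using u by blast
    have tree: "is_tree U ?S" using is_tree_add_leaf[OF S(1) p(1), of u] U by simp
    interpret S: finite_tree U ?S by unfold_locales (rule tree)
    note old = aligned_add_leaf(1)[OF S(1) p(1), of u, unfolded U]
    note new = aligned_add_leaf(2)[OF S(1) p(1), of u, unfolded U]
    have flowu: "aligned U ?S u x w" if "x \<in> U" "w \<in> ?W" "B u x w" for x w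
    proof (cases "x = u")
      case False
      have V: "u \<in> V" "x \<in> V" "w \<in> V" "p \<in> V" using less.prems that u p by auto
      \<comment> \<open>A vertex of \<open>U\<close> other than \<open>u\<close> and \<open>p\<close> between them would be closer to \<open>u\<close> than \<open>p\<close>.\<close>
      have "B p x w"
      proof (cases "B u x p")
        case True
        have "x = p"
          using card_interval_less[OF V(1,4) True] p(2)[of x] False that(1) unfolding d_def by fastforce
        then show ?thesis using aligned_ends V by simp
      next
        case False
        then show ?thesis using aligned_split[OF V(1,3,4) that(3)] by blast
      qed
      then have "aligned ?W S p x w" using S(2) p(1) that False unfolding flows_with_def by blast
      then show ?thesis using new that by simp
    qed (use new that in simp)
    have "aligned U ?S v x w" if vxw: "v \<in> U" "x \<in> U" "w \<in> U" "B v x w" for v x w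
    proof -
      consider "v = w" | "v = u" "w \<in> ?W" | "w = u" "v \<in> ?W" | "v \<in> ?W" "w \<in> ?W" using vxw by blast
      then show ?thesis
      proof cases
        case 1
        then have "x = v" using aligned_self vxw less.prems by blast
        then show ?thesis using S.aligned_ends(1) vxw by simp
      next
        case 2
        then show ?thesis using flowu vxw by blast
      next
        case 3
        then have "aligned U ?S u x v" using flowu[of x v] aligned_sym[of v w x] vxw less.prems by blast
        then show ?thesis using S.aligned_sym 3 vxw by blast
      next
        case 4
        then have "x \<in> ?W" using between[OF vxw(1,3)] vxw by blast
        then have "aligned ?W S v x w" using S(2) 4 vxw(4) unfolding flows_with_def by blast
        then show ?thesis using old 4 by simp
      qed
    qed
    then have "flows_with U ?S V E" unfolding flows_with_def by blast
    then show ?thesis using tree by blast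
  qed
qed

text \<open>Neighbours in \<open>U\<close>: no further vertex of \<open>U\<close> lies between them.\<close>
definition adj :: "'v set \<Rightarrow> 'v \<Rightarrow> 'v \<Rightarrow> bool" where
  "adj U v w \<longleftrightarrow> v \<in> U \<and> w \<in> U \<and> v \<noteq> w \<and> (\<forall>x\<in>U. B v x w \<longrightarrow> x = v \<or> x = w)"

lemma adj_sym: "U \<subseteq> V \<Longrightarrow> adj U v w \<Longrightarrow> adj U w v"
  unfolding adj_def using aligned_sym by blast

text \<open>Two neighbours of \<open>v\<close> in the same direction are neighbours of each other, and the three
  vertices involve only three variables: \<open>arc v s = arc v w\<close>, \<open>arc s v = arc s w\<close> and
  \<open>arc w v = arc w s\<close>.\<close>
lemma adj_shortcut:
  assumes "U \<subseteq> V" "adj U v s" "adj U v w" "nbr v s = nbr v w" "s \<noteq> w"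
  shows "adj U s w" "nbr s v = nbr s w" "nbr w v = nbr w s"
proof -
  have V: "v \<in> V" "s \<in> V" "w \<in> V" and U: "v \<in> U" "s \<in> U" "w \<in> U" and ne: "v \<noteq> s" "v \<noteq> w"
    using assms by (auto simp: adj_def)
  have v: "\<not> B s v w" using nbr_eq_iff V ne assms(4) by blast
  have s: "\<not> B v s w" using assms(3,5) U ne unfolding adj_def by blast
  have w: "\<not> B v w s" using assms(2,5) U ne unfolding adj_def by blast
  have "x = s \<or> x = w" if "x \<in> U" "B s x w" for x
    using aligned_split[OF V(2,3,1) that(2)] aligned_sym[OF V(2,1)] v that assms(2,3) unfolding adj_def by blast
  then show "adj U s w" using U assms(5) unfolding adj_def by blast
  show "nbr s v = nbr s w" using nbr_eq_iff[of s v w] V ne s assms(5) by blast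
  show "nbr w v = nbr w s" using nbr_eq_iff[of w v s] V ne w assms(5) by blast
qed

text \<open>For neighbours \<open>v\<close>, \<open>w\<close> in \<open>U\<close> let \<open>s\<close> follow \<open>v\<close> on the \<open>S\<close>-path to \<open>w\<close>. Since \<open>S\<close> flows with
  the tree, \<open>s\<close> lies in the same direction from \<open>v\<close> as \<open>w\<close>, and therefore
  \<open>h\<^sub>v\<^sub>,\<^sub>w = h\<^sub>v\<^sub>,\<^sub>s + h\<^sub>s\<^sub>,\<^sub>w\<close>, which allows induction along the \<open>S\<close>-path.\<close>
lemma tree_space_flowing:
  assumes "U \<subseteq> V" and S: "is_tree U S" "flows_with U S V E"
  shows "tree_space V E S = mp.span {tree_diff V E v w :: ('v set \<times> 'v, 'k::field) mpoly | v w. adj U v w}"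
proof -
  let ?L = "tree_space V E S :: ('v set \<times> 'v, 'k) mpoly set"
  interpret S: finite_tree U S by unfold_locales (rule S)
  have flow: "S.B v x w" if "v \<in> U" "x \<in> U" "w \<in> U" "B v x w" for v x w
    using S(2) that unfolding flows_with_def by blast
  have edge: "adj U v w" if "{v, w} \<in> S" for v w
    using S.edgeD[OF that] S.aligned_edge[OF that] flow unfolding adj_def by blast
  have gen: "tree_diff V E v w \<in> ?L" if "{v, w} \<in> S" for v w
    unfolding tree_space_def using that S.edgeD(3)[OF that] by (intro mp.span_base) blast
  have "tree_diff V E v w \<in> ?L" if "adj U v w" for v w
    using that
  proof (induction "card {x \<in> U. S.B w x v}" arbitrary: v rule: less_induct)
    case less
    have vw: "v \<in> U" "w \<in> U" "v \<noteq> w" using less.prems by (auto simp: adj_def)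
    define s where "s = S.nbr v w"
    have vs: "{v, s} \<in> S" "S.B v s w" using S.nbr[OF vw] by (simp_all add: s_def)
    note s = S.edgeD[OF vs(1)]
    show ?case
    proof (cases "s = w")
      case True
      then show ?thesis using gen vs(1) by blast
    next
      case False
      have V: "v \<in> V" "w \<in> V" "s \<in> V" using assms(1) vw s by auto
      have "\<not> S.B s v w" using S.aligned_edge_not_both[OF vs(1) vw(2) vs(2)] .
      then have "\<not> B s v w" using flow vw s by blast
      then have nbr: "nbr v s = nbr v w" using nbr_eq_iff[of v s w] V s(3) vw(3) by blast
      note short = adj_shortcut[OF assms(1) edge[OF vs(1)] less.prems nbr False]
      have "S.B w s v" using S.aligned_sym vs(2) vw by blast
      then have "card {x \<in> U. S.B w x s} < card {x \<in> U. S.B w x v}"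
        using S.card_interval_less[of w v s] vw s(3) by blast
      then have "tree_diff V E s w \<in> ?L" using less.hyps short(1) by blast
      moreover have "tree_diff V E v w = tree_diff V E v s + (tree_diff V E s w :: ('v set \<times> 'v, 'k) mpoly)"
        using short(2,3) nbr V vw(3) s(3) False by (simp add: tree_diff_eq arc_def)
      moreover have "tree_diff V E v s \<in> ?L" using gen vs(1) .
      ultimately show ?thesis unfolding tree_space_def by (simp add: mp.span_add)
    qed
  qed
  then have "mp.span {tree_diff V E v w :: ('v set \<times> 'v, 'k) mpoly | v w. adj U v w} \<subseteq> ?L"
    unfolding tree_space_def by (intro mp.span_minimal mp.subspace_span) blast
  moreover have "?L \<subseteq> mp.span {tree_diff V E v w | v w. adj U v w}"
    unfolding tree_space_def using edge by (intro mp.span_mono) blast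
  ultimately show ?thesis by blast
qed

lemma subset_space_eq:
  assumes "U \<subseteq> V" "U \<noteq> {}"
  shows "subset_space V E U = mp.span {tree_diff V E v w :: ('v set \<times> 'v, 'k::field) mpoly | v w. adj U v w}"
proof -
  obtain S where "is_tree U S" "flows_with U S V E" using exists_flowing_tree[OF assms] by blast
  then show ?thesis
    unfolding subset_space_def using tree_space_flowing[OF assms(1)]
    by (intro the_equality) (blast, force)
qed

end

section \<open>The space of a partition\<close>

context finite_tree
begin

lemma adj_chain:
  assumes "U \<subseteq> V" "v \<in> U" "w \<in> U"
  shows "(v, w) \<in> {(x, y). adj U x y}\<^sup>*"
  using assms(2,3)
proof (induction "card {x \<in> V. B v x w}" arbitrary: v w rule: less_induct)
  case less
  show ?case
  proof (cases "v = w \<or> adj U v w")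
    case False
    then obtain u where u: "u \<in> U" "B v u w" "u \<noteq> v" "u \<noteq> w" using less.prems unfolding adj_def by blast
    have V: "v \<in> V" "u \<in> V" "w \<in> V" using assms(1) less.prems u(1) by auto
    have "card {x \<in> V. B v x u} < card {x \<in> V. B v x w}" using card_interval_less V u by blast
    moreover have "card {x \<in> V. B u x w} < card {x \<in> V. B v x w}"
    proof -
      have "{x \<in> V. B w x a} = {x \<in> V. B a x w}" if "a \<in> V" for a using aligned_sym V(3) that by blast
      then show ?thesis using card_interval_less[of w v u] aligned_sym[of v w u] V u by simp
    qed
    ultimately show ?thesis using less.hyps u(1) less.prems rtrancl_trans by meson
  qed auto
qed

text \<open>Neighbours in a common block of \<open>Q\<close>.\<close>
definition block_adj :: "'v set set \<Rightarrow> 'v \<Rightarrow> 'v \<Rightarrow> bool" where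
  "block_adj Q v w \<longleftrightarrow> (\<exists>U\<in>Q. adj U v w)"

lemma block_adjD:
  assumes "partition_on V Q" "block_adj Q v w" shows "v \<in> V" "w \<in> V" "v \<noteq> w"
  using assms by (auto simp: partition_on_def block_adj_def adj_def)

lemma partition_subset: "partition_on V Q \<Longrightarrow> U \<in> Q \<Longrightarrow> U \<subseteq> V \<and> U \<noteq> {}"
  by (auto simp: partition_on_def)

lemma partition_unique: "partition_on V Q \<Longrightarrow> U \<in> Q \<Longrightarrow> W \<in> Q \<Longrightarrow> x \<in> U \<Longrightarrow> x \<in> W \<Longrightarrow> U = W"
  unfolding partition_on_def disjoint_def by blast

lemma partition_space_eq:
  assumes Q: "partition_on V Q"
  shows "partition_space V E Q =
    mp.span {tree_diff V E v w :: ('v set \<times> 'v, 'k::field) mpoly | v w. block_adj Q v w}"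
    (is "_ = mp.span ?G")
proof -
  have U: "subset_space V E U = mp.span {tree_diff V E v w :: ('v set \<times> 'v, 'k) mpoly | v w. adj U v w}"
    if "U \<in> Q" for U
    using subset_space_eq partition_subset[OF Q that] by blast
  have "(\<Union>U\<in>Q. subset_space V E U) \<subseteq> mp.span ?G"
  proof (rule UN_least)
    fix U assume "U \<in> Q"
    then show "subset_space V E U \<subseteq> mp.span ?G"
      unfolding U[OF \<open>U \<in> Q\<close>] by (intro mp.span_mono) (auto simp: block_adj_def)
  qed
  moreover have "?G \<subseteq> (\<Union>U\<in>Q. subset_space V E U)"
  proof
    fix f assume "f \<in> ?G"
    then obtain v w U where "U \<in> Q" "adj U v w" "f = tree_diff V E v w" unfolding block_adj_def by blast
    then have "f \<in> subset_space V E U" unfolding U[OF \<open>U \<in> Q\<close>] by (intro mp.span_base) blast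
    then show "f \<in> (\<Union>U\<in>Q. subset_space V E U)" using \<open>U \<in> Q\<close> by blast
  qed
  ultimately show ?thesis
    unfolding partition_space_def
    by (intro subset_antisym mp.span_minimal[OF _ mp.subspace_span] mp.span_mono)
qed

text \<open>The equivalence relation on variables that belongs to \<open>L(Q)\<close>.\<close>
definition linked :: "'v set set \<Rightarrow> 'v set \<times> 'v \<Rightarrow> 'v set \<times> 'v \<Rightarrow> bool" where
  "linked Q c d \<longleftrightarrow> c = d \<or> (\<exists>v w. block_adj Q v w \<and> c = arc v w \<and> d = arc w v)"

lemma linked_arc:
  assumes Q: "partition_on V Q" and vw: "block_adj Q v w" and "linked Q c (arc v w)"
  shows "linked Q c (arc w v)"
proof -
  obtain U where U: "U \<in> Q" "adj U v w" using vw unfolding block_adj_def by blast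
  note V = block_adjD[OF Q vw]
  consider "c = arc v w" | x y where "block_adj Q x y" "c = arc x y" "arc v w = arc y x"
    using assms(3) unfolding linked_def by blast
  then show ?thesis
  proof cases
    case 1
    then show ?thesis using vw unfolding linked_def by blast
  next
    case 2
    note xy = block_adjD[OF Q 2(1)]
    have y: "y = v" "nbr v x = nbr v w"
      using 2(3) arc_eq_iff[OF V xy(2,1) xy(3)[symmetric]] by auto
    obtain W where W: "W \<in> Q" "adj W x y" using 2(1) unfolding block_adj_def by blast
    have "W = U" using partition_unique[OF Q W(1) U(1)] W(2) U(2) y(1) unfolding adj_def by blast
    then have adjs: "U \<subseteq> V" "adj U v x" "adj U v w"
      using partition_subset[OF Q U(1)] W(2) U(2) y(1) adj_sym by auto
    show ?thesis
    proof (cases "x = w")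
      case True
      then show ?thesis using 2(2) y(1) unfolding linked_def by blast
    next
      case False
      note s = adj_shortcut[OF adjs y(2) False]
      have "c = arc x w" "arc w v = arc w x"
        using 2(2) y(1) s(2,3) by (simp_all add: arc_def)
      then show ?thesis using s(1) U(1) unfolding linked_def block_adj_def by auto
    qed
  qed
qed

lemma block_adj_sym: "partition_on V Q \<Longrightarrow> block_adj Q v w \<Longrightarrow> block_adj Q w v"
  unfolding block_adj_def using adj_sym partition_subset by blast

lemma difference_in_partition_space:
  assumes Q: "partition_on V Q" and c: "c \<in> incidence V E" and d: "d \<in> incidence V E"
    and "Var c - Var d \<in> (partition_space V E Q :: ('v set \<times> 'v, 'k::field) mpoly set)"
  shows "linked Q c d"
proof -
  have "c \<in> {x. linked Q c x} \<longleftrightarrow> d \<in> {x. linked Q c x}"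
  proof (rule span_difference_mem_iff[OF finite_C _ c d assms(4)[unfolded partition_space_eq[OF Q]]])
    fix f :: "('v set \<times> 'v, 'k) mpoly"
    assume "f \<in> {tree_diff V E v w | v w. block_adj Q v w}"
    then obtain v w where vw: "block_adj Q v w" and f: "f = tree_diff V E v w" by blast
    note V = block_adjD[OF Q vw]
    have "f = Var (arc v w) - Var (arc w v)" using f tree_diff_eq[OF V] by simp
    moreover have "linked Q c (arc v w) \<longleftrightarrow> linked Q c (arc w v)"
      using linked_arc[OF Q vw] linked_arc[OF Q block_adj_sym[OF Q vw]] by blast
    ultimately show "\<exists>a\<in>incidence V E. \<exists>b\<in>incidence V E. f = Var a - Var b \<and>
        (a \<in> {x. linked Q c x} \<longleftrightarrow> b \<in> {x. linked Q c x})"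
      using arc_in[OF V] arc_in[OF V(2,1) V(3)[symmetric]] by blast
  qed
  then show ?thesis by (simp add: linked_def)
qed

lemma tree_diff_variable_difference:
  assumes "v \<in> V" "w \<in> V" "v \<noteq> w"
  shows "variable_difference (incidence V E) (tree_diff V E v w :: ('v set \<times> 'v, 'k::field) mpoly)"
  unfolding variable_difference_def tree_diff_eq[OF assms]
  using arc_in[OF assms] arc_in[OF assms(2,1) assms(3)[symmetric]] arc_eq_iff[OF assms assms(2,1) assms(3)[symmetric]] assms(3)
  by (intro bexI[of _ "arc v w"] bexI[of _ "arc w v"]) auto

lemma partition_space_regular:
  assumes Q: "partition_on V Q"
  shows "regular_linear_space (incidence V E) (tree_ideal V E)
    (partition_space V E Q :: ('v set \<times> 'v, 'k::field) mpoly set)"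
proof -
  let ?G = "{tree_diff V E v w :: ('v set \<times> 'v, 'k) mpoly | v w. block_adj Q v w}"
  have "variable_difference (incidence V E) f" if "f \<in> ?G" for f
    using that tree_diff_variable_difference block_adjD[OF Q] by blast
  moreover have "outward ?G"
    unfolding outward_def partition_space_eq[OF Q, symmetric]
  proof (intro ballI impI)
    fix c d assume c: "c \<in> incidence V E" and d: "d \<in> incidence V E" and "c \<noteq> d"
      and "Var c - Var d \<in> (partition_space V E Q :: ('v set \<times> 'v, 'k) mpoly set)"
    then obtain v w where "block_adj Q v w" "c = arc v w" "d = arc w v"
      using difference_in_partition_space[OF Q c d] unfolding linked_def by blast
    then show "half c \<inter> half d = {}" using half_disjoint_iff[OF c d] block_adjD[OF Q] by blast
  qed
  ultimately show ?thesis
    unfolding tree_ideal_eq regular_linear_space_iff using partition_space_eq[OF Q] by blast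
qed

lemma tree_diff_in_partition_space_iff:
  assumes Q: "partition_on V Q" and V: "v \<in> V" "w \<in> V" "v \<noteq> w"
  shows "tree_diff V E v w \<in> (partition_space V E Q :: ('v set \<times> 'v, 'k::field) mpoly set) \<longleftrightarrow> block_adj Q v w"
proof
  note V' = V(2,1) V(3)[symmetric]
  assume "tree_diff V E v w \<in> (partition_space V E Q :: ('v set \<times> 'v, 'k) mpoly set)"
  then have "linked Q (arc v w) (arc w v)"
    unfolding tree_diff_eq[OF V] by (rule difference_in_partition_space[OF Q arc_in[OF V] arc_in[OF V']])
  moreover have "arc v w \<noteq> arc w v" using arc_eq_iff[OF V V'] V by blast
  ultimately obtain x y where xy: "block_adj Q x y" "arc v w = arc x y" "arc w v = arc y x"
    unfolding linked_def by blast
  note X = block_adjD[OF Q xy(1)]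
  have "v = x" "w = y"
    using arc_eq_iff[OF V X] arc_eq_iff[OF V' X(2,1) X(3)[symmetric]] xy by auto
  then show "block_adj Q v w" using xy by simp
next
  assume "block_adj Q v w"
  then show "tree_diff V E v w \<in> (partition_space V E Q :: ('v set \<times> 'v, 'k) mpoly set)"
    unfolding partition_space_eq[OF Q] by (intro mp.span_base) blast
qed

lemma same_block_iff:
  assumes Q: "partition_on V Q" and v: "v \<in> V"
  shows "(\<exists>U\<in>Q. v \<in> U \<and> w \<in> U) \<longleftrightarrow> (v, w) \<in> {(x, y). block_adj Q x y}\<^sup>*"
proof
  assume "\<exists>U\<in>Q. v \<in> U \<and> w \<in> U"
  then obtain U where U: "U \<in> Q" "v \<in> U" "w \<in> U" by blast
  then have "(v, w) \<in> {(x, y). adj U x y}\<^sup>*" using adj_chain partition_subset[OF Q] by blast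
  moreover have "{(x, y). adj U x y}\<^sup>* \<subseteq> {(x, y). block_adj Q x y}\<^sup>*"
    using U(1) by (intro rtrancl_mono) (auto simp: block_adj_def)
  ultimately show "(v, w) \<in> {(x, y). block_adj Q x y}\<^sup>*" by blast
next
  assume "(v, w) \<in> {(x, y). block_adj Q x y}\<^sup>*"
  then show "\<exists>U\<in>Q. v \<in> U \<and> w \<in> U"
  proof induction
    case base
    then show ?case using Q v by (auto simp: partition_on_def)
  next
    case (step y z)
    then obtain U W where "U \<in> Q" "v \<in> U" "y \<in> U" "W \<in> Q" "y \<in> W" "z \<in> W"
      unfolding block_adj_def adj_def by blast
    then show ?case using partition_unique[OF Q] by blast
  qed
qed

lemma partition_space_inj:
  assumes Q: "partition_on V Q" and Q': "partition_on V Q'"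
    and eq: "partition_space V E Q = (partition_space V E Q' :: ('v set \<times> 'v, 'k::field) mpoly set)"
  shows "Q = Q'"
proof -
  have "block_adj Q v w \<longleftrightarrow> block_adj Q' v w" for v w
    using tree_diff_in_partition_space_iff[OF Q, of v w, where 'k = 'k]
      tree_diff_in_partition_space_iff[OF Q', of v w, where 'k = 'k] eq
      block_adjD[OF Q, of v w] block_adjD[OF Q', of v w] by auto
  then have same: "(\<exists>U\<in>Q. v \<in> U \<and> w \<in> U) \<longleftrightarrow> (\<exists>U\<in>Q'. v \<in> U \<and> w \<in> U)" if "v \<in> V" for v w
    using same_block_iff[OF Q that] same_block_iff[OF Q' that] by simp
  have sub: "R \<subseteq> R'"
    if R: "partition_on V R" and R': "partition_on V R'"
      and same: "\<And>v w. v \<in> V \<Longrightarrow> (\<exists>U\<in>R. v \<in> U \<and> w \<in> U) \<longleftrightarrow> (\<exists>U\<in>R'. v \<in> U \<and> w \<in> U)" for R R'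
  proof
    fix U assume U: "U \<in> R"
    obtain v where v: "v \<in> U" "v \<in> V" using partition_subset[OF R U] by blast
    obtain W where W: "W \<in> R'" "v \<in> W" using same[OF v(2), of v] U v by blast
    have "w \<in> U \<longleftrightarrow> w \<in> W" for w
      using same[OF v(2), of w] partition_unique[OF R U] partition_unique[OF R' W(1)] U v W by blast
    then have "U = W" by blast
    then show "U \<in> R'" using W by simp
  qed
  show ?thesis using sub[OF Q Q' same] sub[OF Q' Q same[symmetric]] by blast
qed

end

section \<open>The partition of a regular linear space\<close>

context finite_tree
begin

lemma regular_imp_partition_space:
  assumes "regular_linear_space (incidence V E) (tree_ideal V E) (M :: ('v set \<times> 'v, 'k::field) mpoly set)"
  shows "\<exists>Q. partition_on V Q \<and> partition_space V E Q = M"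
proof -
  obtain X where X: "\<forall>f\<in>X. variable_difference (incidence V E) f" "outward X" "mp.span X = M"
    using assms unfolding tree_ideal_eq regular_linear_space_iff by blast
  have arcs: "\<exists>v\<in>V. \<exists>w\<in>V. v \<noteq> w \<and> c = arc v w \<and> d = arc w v"
    if "c \<in> incidence V E" "d \<in> incidence V E" "c \<noteq> d" "Var c - Var d \<in> M" for c d
    using X(2,3) that half_disjoint_iff[OF that(1,2)] unfolding outward_def by blast
  define D where "D = {(v, w). v \<in> V \<and> w \<in> V \<and> v \<noteq> w \<and> tree_diff V E v w \<in> M}"
  have DV: "v \<in> V" "w \<in> V" "v \<noteq> w" if "(v, w) \<in> D" for v w using that by (auto simp: D_def)
  have D_iff: "(v, w) \<in> D \<longleftrightarrow> Var (arc v w) - Var (arc w v) \<in> M" if "v \<in> V" "w \<in> V" "v \<noteq> w" for v w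
    using that by (simp add: D_def tree_diff_eq)
  have D_sym: "(w, v) \<in> D" if "(v, w) \<in> D" for v w
    using mp.span_neg[of "Var (arc v w) - Var (arc w v)" X] that DV[OF that] D_iff[of v w] D_iff[of w v] X(3)
    by simp
  \<comment> \<open>Two joins \<open>x y\<close> and \<open>y v\<close> in the same direction from \<open>y\<close> share a variable, so they can be
    replaced by the join \<open>x v\<close>.\<close>
  have merge: "(x, v) \<in> D" "nbr x y = nbr x v" "nbr v y = nbr v x"
    if xy: "(x, y) \<in> D" and vy: "(v, y) \<in> D" and ne: "x \<noteq> v" and nbr: "nbr y x = nbr y v" for x y v
  proof -
    note V1 = DV[OF xy] and V2 = DV[OF vy]
    have "arc y x = arc y v" using nbr by (simp add: arc_def)
    then have M: "Var (arc x y) - Var (arc v y) \<in> M"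
      using mp.span_diff[of "Var (arc x y) - Var (arc y x)" X "Var (arc v y) - Var (arc y v)"]
        D_iff[OF V1] D_iff[OF V2] xy vy X(3) by simp
    moreover have "arc x y \<noteq> arc v y" using arc_eq_iff[OF V1 V2] ne by blast
    ultimately obtain a b where ab: "a \<in> V" "b \<in> V" "a \<noteq> b" "arc x y = arc a b" "arc v y = arc b a"
      using arcs[OF arc_in[OF V1] arc_in[OF V2]] by blast
    have "x = a" "nbr x y = nbr a b" "v = b" "nbr v y = nbr b a"
      using ab(4,5) arc_eq_iff[OF V1 ab(1-3)] arc_eq_iff[OF V2 ab(2,1) ab(3)[symmetric]] by auto
    then show nbrs: "nbr x y = nbr x v" "nbr v y = nbr v x" by auto
    then have "arc x v = arc x y" "arc v x = arc v y" by (simp_all add: arc_def)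
    then show "(x, v) \<in> D" using M D_iff[OF V1(1) V2(1) ne] by simp
  qed
  \<comment> \<open>A chain of joins from \<open>u\<close> to \<open>v\<close> can be chosen so that its last join starts between \<open>u\<close> and
    \<open>v\<close>. The lengths are recorded because the case \<open>x = v\<close> below falls back on a shorter chain to \<open>v\<close>.\<close>
  have chain: "\<exists>x m. m < n \<and> (u, x) \<in> D ^^ m \<and> (x, v) \<in> D \<and> B u x v"
    if "u \<in> V" "u \<noteq> v" "(u, v) \<in> D ^^ n" for u v n
    using that(2,3)
  proof (induction n arbitrary: v rule: less_induct)
    case (less n)
    then obtain k where n: "n = Suc k" by (cases n) auto
    then obtain y where y: "(u, y) \<in> D ^^ k" "(y, v) \<in> D" using less.prems(2) by auto
    note yv = DV[OF y(2)]
    show ?case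
    proof (cases "u = y")
      case True
      then show ?thesis using y n aligned_ends(1) yv by (intro exI[of _ u] exI[of _ 0]) simp
    next
      case False
      then obtain x m where x: "m < k" "(u, x) \<in> D ^^ m" "(x, y) \<in> D" "B u x y"
        using less.IH[of k y] y(1) n by blast
      note xy = DV[OF x(3)]
      show ?thesis
      proof (cases "nbr y x = nbr y v")
        case False
        then have "B x y v" using nbr_eq_iff[OF xy(2,1) yv(2) xy(3)[symmetric] yv(3)] by blast
        then have "B u y v" using aligned_extend(1)[OF that(1) xy(1,2) yv(2) x(4) _ xy(3)] by blast
        then show ?thesis using y n by blast
      next
        case nbr: True
        show ?thesis
        proof (cases "x = v")
          case True
          then obtain z l where "l < m" "(u, z) \<in> D ^^ l" "(z, v) \<in> D" "B u z v"
            using less.IH[of m v] x n less.prems(1) by auto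
          then show ?thesis using x(1) n by (intro exI[of _ z] exI[of _ l]) simp
        next
          case False
          note mg = merge[OF x(3) D_sym[OF y(2)] False nbr]
          have "B u x v"
          proof (cases "u = x")
            case True
            then show ?thesis using aligned_ends xy yv by blast
          next
            case neq: False
            have "nbr x u \<noteq> nbr x y" using nbr_eq_iff[OF xy(1) that(1) xy(2) neq[symmetric] xy(3)] x(4) by blast
            then show ?thesis using mg(2) nbr_eq_iff[OF xy(1) that(1) yv(2) neq[symmetric] False] by simp
          qed
          then show ?thesis using mg(1) x n by (intro exI[of _ x] exI[of _ m]) simp
        qed
      qed
    qed
  qed
  define r where "r = {(v, w). v \<in> V \<and> w \<in> V \<and> (v, w) \<in> D\<^sup>*}"
  have "sym (D\<^sup>*)" using D_sym by (intro sym_rtrancl symI)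
  then have equiv: "equiv V r"
    unfolding r_def by (intro equivI refl_onI symI transI) (auto dest: symD)
  define Q where "Q = V // r"
  have Q: "partition_on V Q" unfolding Q_def by (rule partition_on_quotient[OF equiv])
  have "block_adj Q v w \<longleftrightarrow> (v, w) \<in> D" for v w
  proof
    assume "block_adj Q v w"
    then obtain U where U: "U \<in> Q" and adj: "adj U v w" unfolding block_adj_def by blast
    then have vw: "v \<in> U" "w \<in> U" "v \<noteq> w" by (auto simp: adj_def)
    then have "(v, w) \<in> r" using quotient_eqI[OF equiv] U unfolding Q_def
      using in_quotient_imp_in_rel[OF equiv] by blast
    then obtain n where n: "v \<in> V" "(v, w) \<in> D ^^ n" by (auto simp: r_def rtrancl_power)
    obtain x m where x: "(v, x) \<in> D ^^ m" "(x, w) \<in> D" "B v x w" using chain[OF n(1) vw(3) n(2)] by blast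
    have "(v, x) \<in> r" using x(1) n(1) DV[OF x(2)] relpow_imp_rtrancl by (auto simp: r_def)
    then have "x \<in> U" using in_quotient_imp_closed[OF equiv _ vw(1)] U unfolding Q_def by blast
    then have "x = v" using adj x DV[OF x(2)] unfolding adj_def by blast
    then show "(v, w) \<in> D" using x(2) by simp
  next
    assume vw: "(v, w) \<in> D"
    note V = DV[OF vw]
    define U where "U = r `` {v}"
    have U: "U \<in> Q" "v \<in> U" "w \<in> U"
      unfolding U_def Q_def using quotientI[OF V(1)] V vw by (simp, auto simp: r_def)
    \<comment> \<open>If \<open>u\<close> in the same component lay strictly between \<open>v\<close> and \<open>w\<close>, then so would some \<open>x\<close> joined
      to \<open>v\<close>. Then \<open>arc x v\<close> and \<open>arc w v\<close> are equivalent, but \<open>x\<close> and \<open>w\<close> lie in the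
      same direction from \<open>v\<close>, and the two variables do not point away from each other.\<close>
    have "u = v \<or> u = w" if u: "u \<in> U" "B v u w" for u
    proof (rule ccontr)
      assume neq: "\<not> (u = v \<or> u = w)"
      have uV: "u \<in> V" using u(1) unfolding U_def r_def by blast
      have "(u, v) \<in> r" using u(1) equiv unfolding U_def equiv_def sym_def by blast
      then obtain n where "(u, v) \<in> D ^^ n" by (auto simp: r_def rtrancl_power)
      then obtain x where x: "(x, v) \<in> D" "B u x v" using chain[OF uV] neq by blast
      note xv = DV[OF x(1)]
      have vxu: "B v x u" using aligned_sym[OF uV V(1) x(2)] .
      have vxw: "B v x w" using aligned_trans(1)[OF V(1,2) u(2) vxu] .
      have "x \<noteq> w" using aligned_antisym[OF V(1,2) uV u(2)] vxu neq by blast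
      have "\<not> B x v w" using aligned_antisym[of w v x] aligned_sym[OF V(1,2) vxw] aligned_sym[of x w v] xv V by blast
      then have "nbr v x = nbr v w" using nbr_eq_iff[OF V(1) xv(1) V(2) xv(3)[symmetric] V(3)] by blast
      then have "nbr x v = nbr x w" using merge(2)[OF x(1) D_sym[OF vw] \<open>x \<noteq> w\<close>] by blast
      then show False using nbr_eq_iff[OF xv(1) V(1,2) xv(3) \<open>x \<noteq> w\<close>] vxw by blast
    qed
    then show "block_adj Q v w" unfolding block_adj_def adj_def using U V by blast
  qed
  then have space: "partition_space V E Q = mp.span {tree_diff V E v w :: ('v set \<times> 'v, 'k) mpoly | v w. (v, w) \<in> D}"
    using partition_space_eq[OF Q] by simp
  have "partition_space V E Q = M"
  proof
    have "{tree_diff V E v w | v w. (v, w) \<in> D} \<subseteq> M" unfolding D_def by blast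
    then show "partition_space V E Q \<subseteq> M"
      unfolding space X(3)[symmetric] by (rule mp.span_minimal[OF _ mp.subspace_span])
    have "X \<subseteq> {tree_diff V E v w | v w. (v, w) \<in> D}"
    proof
      fix f assume f: "f \<in> X"
      obtain c d where cd: "c \<in> incidence V E" "d \<in> incidence V E" "c \<noteq> d" "f = Var c - Var d"
        using X(1) f unfolding variable_difference_def by blast
      have "f \<in> M" using mp.span_base[OF f] X(3) by simp
      then obtain v w where vw: "v \<in> V" "w \<in> V" "v \<noteq> w" "c = arc v w" "d = arc w v"
        using arcs[OF cd(1-3)] cd(4) by blast
      then have "f = tree_diff V E v w" using cd(4) vw by (simp add: tree_diff_eq)
      then show "f \<in> {tree_diff V E v w | v w. (v, w) \<in> D}" using vw \<open>f \<in> M\<close> unfolding D_def by blast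
    qed
    then show "M \<subseteq> partition_space V E Q"
      unfolding space X(3)[symmetric] by (rule mp.span_mono)
  qed
  then show ?thesis using Q by blast
qed

text \<open>The variables that occur in \<open>L(U)\<close> are directed towards vertices of \<open>U\<close>, so different blocks
  use disjoint sets of variables.\<close>
lemma subset_space_support:
  assumes U: "U \<subseteq> V" "U \<noteq> {}"
    and p: "p \<in> (subset_space V E U :: ('v set \<times> 'v, 'k::field) mpoly set)"
    and m: "Poly_Mapping.lookup p m \<noteq> 0"
  shows "\<exists>v\<in>U. \<exists>w\<in>V. v \<noteq> w \<and> m = mvar (arc v w)"
proof (rule ccontr)
  assume no: "\<not> ?thesis"
  have "subset_space V E U \<subseteq> {p :: ('v set \<times> 'v, 'k) mpoly. Poly_Mapping.lookup p m = 0}"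
    unfolding subset_space_eq[OF U]
  proof (rule mp.span_minimal)
    show "mp.subspace {p :: ('v set \<times> 'v, 'k) mpoly. Poly_Mapping.lookup p m = 0}"
      by (simp add: mp.subspace_def lookup_add lookup_pscale)
    show "{tree_diff V E v w | v w. adj U v w} \<subseteq> {p :: ('v set \<times> 'v, 'k) mpoly. Poly_Mapping.lookup p m = 0}"
    proof
      fix f :: "('v set \<times> 'v, 'k) mpoly" assume "f \<in> {tree_diff V E v w | v w. adj U v w}"
      then obtain v w where vw: "v \<in> U" "w \<in> U" "v \<noteq> w" and f: "f = tree_diff V E v w"
        by (auto simp: adj_def)
      have "f = Var (arc v w) - Var (arc w v)" unfolding f using vw U by (intro tree_diff_eq) auto
      moreover have "m \<noteq> mvar (arc a b)" if "a \<in> U" "b \<in> U" "a \<noteq> b" for a b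
        using no that U(1) by auto
      then have "m \<noteq> mvar (arc v w)" "m \<noteq> mvar (arc w v)" using vw by auto
      ultimately show "f \<in> {p. Poly_Mapping.lookup p m = 0}"
        by (auto simp: lookup_minus Var_def lookup_single when_def)
    qed
  qed
  then show False using p m by blast
qed

lemma partition_space_direct_sum:
  assumes Q: "partition_on V Q"
  shows "is_direct_sum (partition_space V E Q :: ('v set \<times> 'v, 'k::field) mpoly set) Q (subset_space V E)"
proof -
  have finQ: "finite Q" using finite_elements[OF finite_V Q] .
  let ?L = "\<lambda>U. subset_space V E U :: ('v set \<times> 'v, 'k) mpoly set"
  let ?R = "{\<Sum>U\<in>Q. f U | f. \<forall>U\<in>Q. f U \<in> ?L U}"
  note U = partition_subset[OF Q]
  have sub: "mp.subspace (?L W)" if "W \<in> Q" for W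
    unfolding subset_space_eq[OF conjunct1[OF U[OF that]] conjunct2[OF U[OF that]]] by (rule mp.subspace_span)
  have "partition_space V E Q = ?R"
  proof
    have "mp.subspace ?R"
    proof (rule mp.subspaceI)
      show "0 \<in> ?R"
        by (intro CollectI exI[of _ "\<lambda>_. 0"]) (auto intro: mp.subspace_0[OF sub])
      show "x + y \<in> ?R" if x: "x \<in> ?R" and y: "y \<in> ?R" for x y
      proof -
        obtain f where "x = (\<Sum>U\<in>Q. f U)" "\<forall>U\<in>Q. f U \<in> ?L U" using x by blast
        moreover obtain g where "y = (\<Sum>U\<in>Q. g U)" "\<forall>U\<in>Q. g U \<in> ?L U" using y by blast
        ultimately show ?thesis
          by (intro CollectI exI[of _ "\<lambda>U. f U + g U"]) (auto simp: sum.distrib intro: mp.subspace_add[OF sub])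
      qed
      show "pscale c x \<in> ?R" if x: "x \<in> ?R" for c x
      proof -
        obtain f where "x = (\<Sum>U\<in>Q. f U)" "\<forall>U\<in>Q. f U \<in> ?L U" using x by blast
        then show ?thesis
          by (intro CollectI exI[of _ "\<lambda>U. pscale c (f U)"]) (auto simp: mp.scale_sum_right intro: mp.subspace_scale[OF sub])
      qed
    qed
    moreover have "?L W \<subseteq> ?R" if W: "W \<in> Q" for W
    proof
      fix p assume "p \<in> ?L W"
      then show "p \<in> ?R"
        using W finQ
        by (intro CollectI exI[of _ "\<lambda>U. if U = W then p else 0"]) (auto intro: mp.subspace_0[OF sub])
    qed
    ultimately show "partition_space V E Q \<subseteq> ?R"
      unfolding partition_space_def by (intro mp.span_minimal UN_least)
    show "?R \<subseteq> partition_space V E Q"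
      unfolding partition_space_def by (auto intro!: mp.span_sum intro: mp.span_base)
  qed
  moreover have "f W = 0" if f: "\<forall>U\<in>Q. f U \<in> ?L U" "(\<Sum>U\<in>Q. f U) = 0" and W: "W \<in> Q" for f W
  proof (rule poly_mapping_eqI, rule ccontr)
    fix m assume "Poly_Mapping.lookup (f W) m \<noteq> Poly_Mapping.lookup 0 m"
    then have m: "Poly_Mapping.lookup (f W) m \<noteq> 0" by simp
    have "Poly_Mapping.lookup (f U') m = 0" if U': "U' \<in> Q - {W}" for U'
    proof (rule ccontr)
      assume m': "Poly_Mapping.lookup (f U') m \<noteq> 0"
      obtain v w where v: "v \<in> W" "w \<in> V" "v \<noteq> w" "m = mvar (arc v w)"
        using subset_space_support[OF _ _ _ m] U[OF W] f(1) W by blast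
      obtain x y where x: "x \<in> U'" "y \<in> V" "x \<noteq> y" "m = mvar (arc x y)"
        using subset_space_support[OF _ _ _ m'] U[of U'] f(1) U' by blast
      have "arc v w = arc x y" using v(4) x(4) by simp
      then have "v = x" using arc_eq_iff[of v w x y] v x U[OF W] U[of U'] U' by blast
      then show False using partition_unique[OF Q W, of U' v] U' v x by blast
    qed
    then have "Poly_Mapping.lookup (\<Sum>U\<in>Q. f U) m = Poly_Mapping.lookup (f W) m"
      by (simp add: sum.remove[OF finQ W] lookup_add lookup_sum)
    then show False using m f(2) by simp
  qed
  ultimately show ?thesis unfolding is_direct_sum_def by blast
qed

end

section \<open>The correspondence\<close>

theorem theorem5p16:
  fixes V :: "'v set" and E :: "'v set set"
  defines "L \<equiv> (partition_space V E :: 'v set set \<Rightarrow> ('v set \<times> 'v, 'k::field) mpoly set)"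
  assumes "is_tree V E"
  shows "bij_betw L {Q. partition_on V Q}
           {M. regular_linear_space (incidence V E) (tree_ideal V E) M} \<and>
         (\<forall>Q. partition_on V Q \<longrightarrow> is_direct_sum (L Q) Q (subset_space V E))"
proof -
  interpret finite_tree V E by unfold_locales (rule assms(2))
  have "inj_on L {Q. partition_on V Q}"
    unfolding L_def by (rule inj_onI) (use partition_space_inj in blast)
  moreover have "L ` {Q. partition_on V Q} = {M. regular_linear_space (incidence V E) (tree_ideal V E) M}"
    using partition_space_regular regular_imp_partition_space unfolding L_def by blast
  ultimately show ?thesis
    unfolding bij_betw_def using partition_space_direct_sum unfolding L_def by blast
qed

end
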